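(* Let $\{A_m\}_{m\in\mathbb{Z}\setminus\{0\}}$ be complex numbers such that the two $L$-series $L_\epsilon(s)=\sum_{m=1}^\infty\frac{A_m+(-1)^\epsilon A_{-m}}{m^s}$, $\epsilon=0,1$, converge in some right half-plane $\{\Re(s)>\alpha\}$, $\alpha\ge0$, and the completed $L$-functions $\Lambda_\epsilon(s)=\gamma(s+\epsilon)L_\epsilon(s)$, with $\gamma(s)=\frac{1}{4\pi^s}\Gamma(s/2)^2$, are entire of finite order and satisfy $\Lambda_\epsilon(1-s)=(-1)^\epsilon\Lambda_\epsilon(s)$. Let $f:\mathbb{C}\setminus\mathbb{R}\to\mathbb{C}$ be $f(y)=\sum_{m>0}A_me^{2\pi i m y}$ for $\Im(y)>0$ and $f(y)=-\sum_{m<0}A_me^{2\pi imy}$ for $\Im(y)<0$. Then the restriction of $f$ to the upper half-plane $\mathbb{H}$, and likewise its restriction to the lower half-plane $\mathbb{H}_-$, is a weight-$1$ holomorphic quantum modular form for $\mathsf{SL}_2(\mathbb{Z})$.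
   Context: For $\gamma=\begin{pmatrix}a&b\\c&d\end{pmatrix}\in\mathsf{SL}_2(\mathbb{Z})$ and weight $w$, the cocycle of $f$ is $h_\gamma[f](y)=(cy+d)^{-w}f\!\left(\frac{ay+b}{cy+d}\right)-f(y)$. An analytic function $f:\mathbb{H}\to\mathbb{C}$ is a weight-$w$ holomorphic quantum modular form for a subgroup $\Gamma\subseteq\mathsf{SL}_2(\mathbb{Z})$ if for every $\gamma\in\Gamma$ the cocycle $h_\gamma[f]:\mathbb{H}\to\mathbb{C}$ extends holomorphically to $\mathbb{C}_\gamma=\{y\in\mathbb{C}: cy+d\in\mathbb{C}\setminus\mathbb{R}_{\le0}\}$. The analogous definition is used for analytic functions on the lower half-plane $\mathbb{H}_-$ (with $h_\gamma[f]:\mathbb{H}_-\to\mathbb{C}$ required to extend holomorphically to $\mathbb{C}_\gamma$). *)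

theory Defs
  imports "HOL-Complex_Analysis.Complex_Analysis"
begin

definition upper_hp :: "complex set" where
  "upper_hp = {y. Im y > 0}"

definition lower_hp :: "complex set" where
  "lower_hp = {y. Im y < 0}"

text \<open>SL_2(Z), matrices (a,b,c,d) standing for [[a,b],[c,d]].\<close>
definition SL2Z :: "(int \<times> int \<times> int \<times> int) set" where
  "SL2Z = {(a, b, c, d). a * d - b * c = 1}"

definition cocycle :: "complex \<Rightarrow> int \<times> int \<times> int \<times> int \<Rightarrow> (complex \<Rightarrow> complex) \<Rightarrow> complex \<Rightarrow> complex" where
  "cocycle w g f y = (case g of (a, b, c, d) \<Rightarrow>
      (of_int c * y + of_int d) powr (- w) *
        f ((of_int a * y + of_int b) / (of_int c * y + of_int d)) - f y)"

definition C_gamma :: "int \<times> int \<times> int \<times> int \<Rightarrow> complex set" where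
  "C_gamma g = (case g of (a, b, c, d) \<Rightarrow>
      {y. \<not> (of_int c * y + of_int d \<in> \<real> \<and> Re (of_int c * y + of_int d) \<le> 0)})"

definition holo_qmf_on :: "complex set \<Rightarrow> complex \<Rightarrow> (int \<times> int \<times> int \<times> int) set \<Rightarrow> (complex \<Rightarrow> complex) \<Rightarrow> bool" where
  "holo_qmf_on D w \<Gamma> f \<longleftrightarrow>
     f analytic_on D \<and>
     (\<forall>g\<in>\<Gamma>. \<exists>h. h holomorphic_on C_gamma g \<and> (\<forall>y\<in>D. h y = cocycle w g f y))"

definition gam :: "complex \<Rightarrow> complex" where
  "gam s = Gamma (s / 2) ^ 2 / (4 * of_real pi powr s)"

definition Lser :: "(int \<Rightarrow> complex) \<Rightarrow> nat \<Rightarrow> complex \<Rightarrow> complex" where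
  "Lser A \<epsilon> s = (\<Sum>m. (A (int m + 1) + (-1) ^ \<epsilon> * A (- (int m + 1))) / of_nat (m + 1) powr s)"

definition finite_order :: "(complex \<Rightarrow> complex) \<Rightarrow> bool" where
  "finite_order F \<longleftrightarrow> (\<exists>\<rho> R. \<forall>z. norm z \<ge> R \<longrightarrow> norm (F z) \<le> exp (norm z powr \<rho>))"

definition fA :: "(int \<Rightarrow> complex) \<Rightarrow> complex \<Rightarrow> complex" where
  "fA A y = (if Im y > 0 then (\<Sum>m. A (int m + 1) * exp (2 * of_real pi * \<i> * of_nat (m + 1) * y))
             else if Im y < 0 then - (\<Sum>m. A (- (int m + 1)) * exp (2 * of_real pi * \<i> * (- of_nat (m + 1)) * y))
             else 0)"

end

(*
  Let P_0(s) and P_1(s) be constant multiples of Lambda_0(s) G((s+1)/2) G(1-s/2) and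
  Lambda_1(s) G(s/2) G((1-s)/2), where G is the Gamma function.  The functional equations say
  P_0(1-s) = P_0(s) and P_1(1-s) = -P_1(s), and (2 pi)^(-s) G(s) L_e(s) is P_0(s) sin(pi s/2)
  for e = 0 and P_1(s) cos(pi s/2) for e = 1.  Phragmen-Lindelof in vertical half-strips (where
  the finite order enters) gives P_e(s) = O(exp(-b |Im s|)) for every b < pi, so the Mellin
  inversion formula for f on the upper half-plane can be moved to Re s = 1/2.  Writing sin and
  cos through exponentials there gives f = V + U with

    V(y) = (2 pi i)^(-1) int (i P_0 + P_1)(s)/4 y^(-s) ds,
    U(y) = (2 pi i)^(-1) int (-i P_0 + P_1)(s)/4 (-y)^(-s) ds,

  where V is holomorphic off the nonpositive and U off the nonnegative real axis.  The
  substitution s -> 1-s shows V|S = U and U|S = -V, so the cocycles at S and -S are -2V and -2U.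
  Every other element of SL_2(Z) is reached from S, -S and translations by a Euclidean descent
  on |c| which keeps track of the cut, and y -> -y carries the result to the lower half-plane.
*)
theory Submission
  imports Defs
begin

section \<open>The cocycle relation\<close>

text \<open>The functional equations carry the factor Gamma((s + \<epsilon>)/2)^2, as for Maass
  forms of eigenvalue 1/4, while the Mellin transform of exp(2 pi i m y) brings in (2 pi)^(-s)
  Gamma(s). The quotient of the two is not symmetric under s -> 1 - s; splitting off a sine or
  cosine makes the rest symmetric, and the sine and cosine are what keeps \<open>f\<close> from
  being modular. The splitting also governs domains of holomorphy. An integral of k(s) y^(-s) over a
  vertical line, with k decaying like exp(-b |Im s|), converges for |arg y| < b. The product of P
  and the trigonometric factor decays at rates below pi/2, just enough for -i y with y in the upper
  half-plane; P alone decays at all rates below pi, and this yields the two slit planes. The other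
  obstacle lies in the group. A cocycle relation extends a cocycle only to the part of the plane
  where both of its terms live, so an arbitrary factorisation into generators loses part of
  \<open>C_gamma\<close>. The weight being odd, the matrices S and -S have different cocycles as
  well as opposite cuts, and both are needed as base cases.\<close>

lemma cocycle_one:
  "cocycle 1 (a, b, c, d) f y =
     f ((of_int a * y + of_int b) / (of_int c * y + of_int d)) / (of_int c * y + of_int d) - f y"
  by (simp add: cocycle_def powr_minus divide_inverse)

lemma C_gamma_iff:
  "y \<in> C_gamma (a, b, c, d) \<longleftrightarrow>
     \<not> (Im (of_int c * y + of_int d) = 0 \<and> Re (of_int c * y + of_int d) \<le> 0)"
  by (simp add: C_gamma_def complex_is_Real_iff)

definition cocycle_extends :: "(complex \<Rightarrow> complex) \<Rightarrow> int \<times> int \<times> int \<times> int \<Rightarrow> bool" where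
  "cocycle_extends f g \<longleftrightarrow>
     (\<exists>h. h holomorphic_on C_gamma g \<and> (\<forall>y\<in>upper_hp. h y = cocycle 1 g f y))"

lemma periodic_int:
  assumes "\<And>y. y \<in> upper_hp \<Longrightarrow> f (y + 1) = f y" "y \<in> upper_hp"
  shows "f (y + of_int n) = f y"
proof -
  have nat: "f (z + of_nat k) = f z" if "z \<in> upper_hp" for k z
  proof (induction k)
    case (Suc k)
    then show ?case using assms(1)[of "z + of_nat k"] that by (simp add: upper_hp_def algebra_simps)
  qed simp
  show ?thesis
  proof (cases "n \<ge> 0")
    case True
    then show ?thesis using nat[OF assms(2), of "nat n"] by simp
  next
    case False
    then show ?thesis using nat[of "y + of_int n" "nat (- n)"] assms(2)
      by (simp add: upper_hp_def)
  qed
qed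

lemma moebius_upper_hp:
  assumes "a * d - b * c = 1" "y \<in> upper_hp"
  shows "of_int c * y + of_int d \<noteq> 0"
    and "(of_int a * y + of_int b) / (of_int c * y + of_int d) \<in> upper_hp"
proof -
  let ?w = "of_int c * y + of_int d :: complex"
  have y: "Im y > 0" using assms by (simp add: upper_hp_def)
  have "c \<noteq> 0 \<or> d \<noteq> 0" using assms(1) by auto
  then show nz: "?w \<noteq> 0" using y by (auto simp: complex_eq_iff)
  have "Im ((of_int a * y + of_int b) * cnj ?w) = of_int (a * d - b * c) * Im y"
    by (simp add: algebra_simps)
  then have "Im ((of_int a * y + of_int b) * cnj ?w) > 0" using assms(1) y by simp
  then have "Im ((of_int a * y + of_int b) / ?w) > 0"
    using nz by (simp add: complex_div_cnj[of _ ?w] zero_less_power2 flip: of_real_power)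
  then show "(of_int a * y + of_int b) / ?w \<in> upper_hp" by (simp add: upper_hp_def)
qed

text \<open>The quadruple in the hypothesis is g T^n, with T the unit translation. By periodicity of
  \<open>f\<close> the cocycle of g at y is that of g T^n at y - n, and the domain
  \<open>C_gamma\<close> moves along.\<close>

lemma cocycle_extends_translate:
  assumes "cocycle_extends f (a, b + n * a, c, d + n * c)"
    and per: "\<And>y. y \<in> upper_hp \<Longrightarrow> f (y + 1) = f y"
  shows "cocycle_extends f (a, b, c, d)"
proof -
  obtain h where h: "h holomorphic_on C_gamma (a, b + n * a, c, d + n * c)"
    "\<And>y. y \<in> upper_hp \<Longrightarrow> h y = cocycle 1 (a, b + n * a, c, d + n * c) f y"
    using assms(1) unfolding cocycle_extends_def by blast
  have eq: "of_int a * (y - of_int n) + of_int (b + n * a) = (of_int a * y + of_int b :: complex)"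
    "of_int c * (y - of_int n) + of_int (d + n * c) = (of_int c * y + of_int d :: complex)" for y
    by (simp_all add: algebra_simps)
  have "(h \<circ> (\<lambda>y. y - of_int n)) holomorphic_on C_gamma (a, b, c, d)"
  proof (rule holomorphic_on_compose_gen[OF _ h(1)])
    show "(\<lambda>y. y - of_int n) ` C_gamma (a, b, c, d) \<subseteq> C_gamma (a, b + n * a, c, d + n * c)"
      unfolding C_gamma_def case_prod_conv image_subset_iff mem_Collect_eq eq by blast
  qed (intro holomorphic_intros)
  moreover have "(h \<circ> (\<lambda>y. y - of_int n)) y = cocycle 1 (a, b, c, d) f y" if "y \<in> upper_hp" for y
  proof -
    have "y - of_int n \<in> upper_hp" using that by (simp add: upper_hp_def)
    then show ?thesis using h(2)[of "y - of_int n"] periodic_int[of f, OF per, of "y - of_int n" n]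
      unfolding o_def by (simp only: cocycle_one eq) simp
  qed
  ultimately show ?thesis unfolding cocycle_extends_def by blast
qed

text \<open>The cocycle relation \<open>h\<^bsub>g1 g2\<^esub> = h\<^bsub>g1\<^esub> | g2 + h\<^bsub>g2\<^esub>\<close> for
  \<open>g2 = [[0,-s],[s,0]]\<close> and \<open>g1 = g g2\<^sup>-\<^sup>1\<close>.  The sign of \<open>d\<close> is what makes both
  \<open>C_gamma g \<subseteq> C_gamma g2\<close> and \<open>g2 (C_gamma g) \<subseteq> C_gamma g1\<close> true.\<close>
lemma cocycle_extends_step:
  assumes det: "a * d - b * c = 1" and s: "s = 1 \<or> s = -1" and c: "s * c > 0" and d: "d < 0"
    and g2: "cocycle_extends f (0, - s, s, 0)"
    and g1: "cocycle_extends f (- s * b, s * a, - s * d, s * c)"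
  shows "cocycle_extends f (a, b, c, d)"
proof -
  let ?s = "of_int s :: complex"
  have ss: "?s * ?s = 1" using s by auto
  have snz: "?s \<noteq> 0" using s by auto
  obtain h1 where h1: "h1 holomorphic_on C_gamma (- s * b, s * a, - s * d, s * c)"
    "\<And>y. y \<in> upper_hp \<Longrightarrow> h1 y = cocycle 1 (- s * b, s * a, - s * d, s * c) f y"
    using g1 unfolding cocycle_extends_def by blast
  obtain h2 where h2: "h2 holomorphic_on C_gamma (0, - s, s, 0)"
    "\<And>y. y \<in> upper_hp \<Longrightarrow> h2 y = cocycle 1 (0, - s, s, 0) f y"
    using g2 unfolding cocycle_extends_def by blast
  \<comment> \<open>A real y with s y <= 0 has c y = (s c) (s y) <= 0, hence c y + d < 0: the cut of
    g2 lies inside the cut of g.\<close>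
  have sub2: "C_gamma (a, b, c, d) \<subseteq> C_gamma (0, - s, s, 0)"
  proof
    fix y assume y: "y \<in> C_gamma (a, b, c, d)"
    show "y \<in> C_gamma (0, - s, s, 0)"
    proof (rule ccontr)
      assume "\<not> ?thesis"
      then have re: "Im y = 0" "of_int s * Re y \<le> 0"
        using s by (auto simp: C_gamma_def complex_is_Real_iff)
      have "of_int c * Re y = of_int (s * c) * (of_int s * Re y)" using s by auto
      also have "\<dots> \<le> 0"
        using c re(2) by (meson mult_nonneg_nonpos less_imp_le of_int_0_le_iff)
      finally show False using y d re by (auto simp: C_gamma_def complex_is_Real_iff)
    qed
  qed
  have nz: "y \<noteq> 0" if "y \<in> C_gamma (a, b, c, d)" for y
    using sub2 that by (auto simp: C_gamma_def)
  \<comment> \<open>The denominator of g1 at -1/y is s (c y + d) / y. If this is real, then so is y,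
    because d is nonzero; then s y > 0 by \<open>sub2\<close>, so its sign is the sign of c y +
    d.\<close>
  have sub1: "- 1 / y \<in> C_gamma (- s * b, s * a, - s * d, s * c)"
    if y: "y \<in> C_gamma (a, b, c, d)" for y
  proof (rule ccontr)
    assume "\<not> ?thesis"
    then have "Im (of_int (- s * d) * (- 1 / y) + of_int (s * c)) = 0"
      "Re (of_int (- s * d) * (- 1 / y) + of_int (s * c)) \<le> 0"
      unfolding C_gamma_iff by blast+
    moreover have "of_int (- s * d) * (- 1 / y) + of_int (s * c) = ?s * (of_int c * y + of_int d) / y"
      using nz[OF y] by (simp add: field_simps)
    ultimately have A: "Im (?s * (of_int c * y + of_int d) / y) = 0"
      "Re (?s * (of_int c * y + of_int d) / y) \<le> 0"
      by (simp_all only:)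
    have B: "?s * (of_int c * y + of_int d) / y = of_int (s * c) + of_int (s * d) * inverse y"
      using nz[OF y] by (simp add: field_simps)
    have "Im (inverse y) = 0" using A(1) s d unfolding B by auto
    then have im: "Im y = 0" using nz[OF y] by (auto simp: complex_eq_iff)
    then have yr: "y = of_real (Re y)" by (simp add: complex_eq_iff)
    have pos: "of_int s * Re y > 0"
      using sub2 y im nz[OF y] by (auto simp: C_gamma_def complex_is_Real_iff)
    have "(of_int s * (of_int c * Re y + of_int d)) / Re y \<le> 0"
    proof -
      have "?s * (of_int c * y + of_int d) / y =
          of_real ((of_int s * (of_int c * Re y + of_int d)) / Re y)"
        by (subst (1 2) yr) simp
      then show ?thesis using A(2) by (simp only: Re_complex_of_real)
    qed
    then have "of_int c * Re y + of_int d \<le> 0"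
      using s pos by (auto simp: divide_simps zero_less_mult_iff mult_le_0_iff split: if_splits)
    then show False using y im by (auto simp: C_gamma_def complex_is_Real_iff)
  qed
  \<comment> \<open>Here s y is the weight-one automorphy factor of g2.\<close>
  define h where "h y = h1 (- 1 / y) / (?s * y) + h2 y" for y
  have "(h1 \<circ> (\<lambda>y. - 1 / y)) holomorphic_on C_gamma (a, b, c, d)"
    by (rule holomorphic_on_compose_gen[OF _ h1(1)])
       (use sub1 nz in \<open>auto intro!: holomorphic_intros\<close>)
  then have "(\<lambda>y. h1 (- 1 / y)) holomorphic_on C_gamma (a, b, c, d)" by (simp add: o_def)
  moreover have "h2 holomorphic_on C_gamma (a, b, c, d)"
    using h2(1) sub2 by (rule holomorphic_on_subset)
  ultimately have "h holomorphic_on C_gamma (a, b, c, d)"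
    unfolding h_def using nz snz by (auto intro!: holomorphic_intros)
  moreover have "h y = cocycle 1 (a, b, c, d) f y" if y: "y \<in> upper_hp" for y
  proof -
    have ynz: "y \<noteq> 0" using y by (auto simp: upper_hp_def)
    have u: "- 1 / y \<in> upper_hp"
      using moebius_upper_hp(2)[of 0 0 "-1" 1 y] y by simp
    have w: "of_int c * y + of_int d \<noteq> (0 :: complex)" by (rule moebius_upper_hp(1)[OF det y])
    have e1: "of_int (- s * d) * (- 1 / y) + of_int (s * c) = ?s * (of_int c * y + of_int d) / y"
      "of_int (- s * b) * (- 1 / y) + of_int (s * a) = ?s * (of_int a * y + of_int b) / y"
      using ynz by (simp_all add: field_simps)
    have e2: "(of_int 0 * y + of_int (- s)) / (?s * y + of_int 0) = - 1 / y"
      using snz by simp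
    have e3: "?s * (of_int a * y + of_int b) / y / (?s * (of_int c * y + of_int d) / y)
        = (of_int a * y + of_int b) / (of_int c * y + of_int d)"
    proof -
      have "?s * (of_int a * y + of_int b) / y / (?s * (of_int c * y + of_int d) / y)
          = (?s / y * (of_int a * y + of_int b)) / (?s / y * (of_int c * y + of_int d))"
        by simp
      then show ?thesis using snz ynz by (simp only: mult_divide_mult_cancel_left divide_eq_0_iff) simp
    qed
    have e4: "X / (?s * (of_int c * y + of_int d) / y) / (?s * y)
        = X / (of_int c * y + of_int d)" for X
    proof -
      have "X / (?s * (of_int c * y + of_int d) / y) / (?s * y) = X / ((?s * ?s) * (of_int c * y + of_int d))"
        using ynz by simp
      then show ?thesis by (simp add: ss)
    qed
    show ?thesis
      unfolding h_def h1(2)[OF u] h2(2)[OF y] cocycle_one e1 e2 e3 diff_divide_distrib e4 by simp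
  qed
  ultimately show ?thesis unfolding cocycle_extends_def by blast
qed

text \<open>A right translation replaces d by a remainder modulo c, and splitting off S or -S on the
  right makes this remainder, up to sign, the new lower left entry. The remainder must be the
  negative one, since the cuts are compatible only for d < 0.\<close>

lemma cocycle_extends_SL2Z:
  assumes per: "\<And>y. y \<in> upper_hp \<Longrightarrow> f (y + 1) = f y"
    and S: "cocycle_extends f (0, - 1, 1, 0)" and S': "cocycle_extends f (0, 1, - 1, 0)"
    and det: "a * d - b * c = 1"
  shows "cocycle_extends f (a, b, c, d)"
  using det
proof (induction "nat \<bar>c\<bar>" arbitrary: a b c d rule: less_induct)
  case less
  show ?case
  proof (cases "\<bar>c\<bar> \<le> 1")
    case False
    define s where "s = sgn c"
    have s: "s = 1 \<or> s = -1" "s * c > 0" "s * c = \<bar>c\<bar>" "s * s = 1"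
      using False by (auto simp: s_def sgn_if)
    \<comment> \<open>With this n the entry d + n c is the remainder of d shifted into the range
      from -|c| to 0.\<close>
    define n where "n = - s * (d div \<bar>c\<bar> + 1)"
    have d': "d + n * c = d mod \<bar>c\<bar> - \<bar>c\<bar>"
    proof -
      have "n * c = - (s * c) * (d div \<bar>c\<bar> + 1)" by (simp add: n_def)
      then show ?thesis by (simp only: s(3)) (simp add: algebra_simps minus_mult_div_eq_mod[symmetric])
    qed
    \<comment> \<open>By coprimality of c and d with |c| >= 2. This excludes the value -|c|, for
      which the descent would stall.\<close>
    have dnz: "d mod \<bar>c\<bar> \<noteq> 0"
    proof
      assume "d mod \<bar>c\<bar> = 0"
      then have "c dvd d" by auto
      then have "c dvd a * d - b * c" by simp
      then show False using less.prems False by auto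
    qed
    have dm: "0 \<le> d mod \<bar>c\<bar>" "d mod \<bar>c\<bar> < \<bar>c\<bar>" using False by auto
    have det': "a * (d + n * c) - (b + n * a) * c = 1"
      using less.prems by (simp add: algebra_simps)
    have "cocycle_extends f (- s * (b + n * a), s * a, - s * (d + n * c), s * c)"
    proof (rule less.hyps)
      show "nat \<bar>- s * (d + n * c)\<bar> < nat \<bar>c\<bar>"
      proof -
        have "\<bar>- s * (d + n * c)\<bar> = \<bar>d + n * c\<bar>" using s(1) by auto
        also have "\<dots> < \<bar>c\<bar>" unfolding d' using dm dnz by linarith
        finally show ?thesis by simp
      qed
      have "- s * (b + n * a) * (s * c) - s * a * (- s * (d + n * c))
          = (s * s) * (a * (d + n * c) - (b + n * a) * c)"
        by (simp add: algebra_simps)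
      then show "- s * (b + n * a) * (s * c) - s * a * (- s * (d + n * c)) = 1"
        using det' s(4) by simp
    qed
    moreover have "cocycle_extends f (0, - s, s, 0)" using s(1) S S' by auto
    ultimately have "cocycle_extends f (a, b + n * a, c, d + n * c)"
      using cocycle_extends_step[OF det' s(1,2)] dm d' by simp
    then show ?thesis using cocycle_extends_translate per by blast
  next
    case True
    show ?thesis
    proof (cases "c = 0")
      case True
      with less.prems have "a = 1 \<and> d = 1 \<or> a = -1 \<and> d = -1"
        by (simp add: zmult_eq_1_iff)
      then show ?thesis
      proof
        assume "a = 1 \<and> d = 1"
        then have "cocycle 1 (a, b, c, d) f y = 0" if "y \<in> upper_hp" for y
          using periodic_int[of f, OF per that, of b] True by (simp add: cocycle_one)
        then show ?thesis unfolding cocycle_extends_def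
          by (intro exI[of _ "\<lambda>_. 0"]) auto
      next
        assume "a = -1 \<and> d = -1"
        \<comment> \<open>Here c y + d is the constant -1. The cocycle equals -2 f, but on the empty
          set there is nothing to extend.\<close>
        then have "C_gamma (a, b, c, d) = {}" using True by (auto simp: C_gamma_def)
        then show ?thesis unfolding cocycle_extends_def
          by (intro exI[of _ "cocycle 1 (a, b, c, d) f"]) (simp add: holomorphic_on_def)
      qed
    next
      case False
      define s where "s = c"
      have s: "s = 1 \<or> s = -1" using False True by (auto simp: s_def)
      have ss: "s * s = 1" using s by auto
      \<comment> \<open>For c = s of absolute value 1, translating by -s d clears the lower right
        entry, and the determinant then forces the upper right one. The entry a that remains only
        adds the integer s a to -1/y, which periodicity removes.\<close>
      have e: "b + - s * d * a = - s"
      proof -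
        have "b + - s * d * a = (s * s) * b - s * d * a" by (simp add: ss)
        also have "\<dots> = - s * (a * d - b * c)" by (simp add: s_def algebra_simps)
        finally show ?thesis using less.prems by simp
      qed
      have e': "d + - s * d * c = 0"
      proof -
        have "d + - s * d * c = d * (1 - s * s)" by (simp add: s_def algebra_simps)
        then show ?thesis by (simp add: ss)
      qed
      have "cocycle 1 (a, - s, s, 0) f y = cocycle 1 (0, - s, s, 0) f y" if y: "y \<in> upper_hp" for y
      proof -
        have u: "- 1 / y \<in> upper_hp"
          using moebius_upper_hp(2)[of 0 0 "-1" 1 y] y by simp
        have "y \<noteq> 0" using y by (auto simp: upper_hp_def)
        then have "(of_int a * y - of_int s) / (of_int s * y) = - 1 / y + of_int (s * a)"
          "- of_int s / (of_int s * y) = - 1 / y"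
          using s by (auto simp: field_simps)
        then show ?thesis using periodic_int[of f, OF per u, of "s * a"] by (simp add: cocycle_one)
      qed
      moreover have "cocycle_extends f (0, - s, s, 0)" using s S S' by auto
      ultimately have "cocycle_extends f (a, - s, s, 0)"
        unfolding cocycle_extends_def C_gamma_def by simp
      then have "cocycle_extends f (a, b + - s * d * a, c, d + - s * d * c)"
        unfolding e e' by (simp add: s_def)
      then show ?thesis using cocycle_extends_translate per by blast
    qed
  qed
qed

section \<open>The Phragmen-Lindelof principle and decay of the Gamma function\<close>

text \<open>The damping factor exp(-\<delta> E(s)) with E(s) = exp(-i \<eta> s) decays doubly
  exponentially in Im s and so beats growth of any finite order. The maximum principle on a tall
  rectangle then gives the bound up to \<delta>.\<close>

lemma phragmen_lindelof_half_strip: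
  fixes G :: "complex \<Rightarrow> complex"
  assumes holo: "G holomorphic_on U" "open U" "{s. a \<le> Re s \<and> Re s \<le> b \<and> \<tau> \<le> Im s} \<subseteq> U"
    and bnd: "\<And>s. a \<le> Re s \<Longrightarrow> Re s \<le> b \<Longrightarrow> \<tau> \<le> Im s \<Longrightarrow>
                Re s = a \<or> Re s = b \<or> Im s = \<tau> \<Longrightarrow> norm (G s) \<le> B"
    and growth: "\<And>s. a \<le> Re s \<Longrightarrow> Re s \<le> b \<Longrightarrow> \<tau>' \<le> Im s \<Longrightarrow>
                norm (G s) \<le> C * exp (norm s powr \<rho> + D * norm s)"
    and s: "a \<le> Re s" "Re s \<le> b" "\<tau> \<le> Im s"
  shows "norm (G s) \<le> B"
proof -
  \<comment> \<open>Keeps |\<eta> x| <= 1 < pi/2 on [a, b], so that Re (E s) >= cos 1 exp(\<eta> Im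
    s) with cos 1 > 0.\<close>
  define \<eta> where "\<eta> = 1 / (1 + \<bar>a\<bar> + \<bar>b\<bar>)"
  have \<eta>: "\<eta> > 0" by (simp add: \<eta>_def)
  have \<eta>le: "\<bar>\<eta> * x\<bar> \<le> 1" if "a \<le> x" "x \<le> b" for x
    using that by (auto simp: \<eta>_def abs_mult field_simps)
  have cos1: "cos (1 :: real) > 0" using cos_gt_zero[of 1] pi_gt3 by simp
  have cosge: "cos (\<eta> * x) \<ge> cos 1" if "a \<le> x" "x \<le> b" for x
  proof -
    have "cos \<bar>\<eta> * x\<bar> \<ge> cos 1"
      using \<eta>le[OF that] pi_gt3 by (intro cos_monotone_0_pi_le) auto
    then show ?thesis by simp
  qed
  define K where "K = \<bar>a\<bar> + \<bar>b\<bar> + 1"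
  have B0: "B \<ge> 0"
  proof -
    have "norm (G (Complex a \<tau>)) \<le> B" using s by (intro bnd) auto
    then show ?thesis using norm_ge_zero order_trans by blast
  qed
  define E where "E s = exp (- \<i> * of_real \<eta> * s)" for s :: complex
  have ReE: "Re (E s) = exp (\<eta> * Im s) * cos (\<eta> * Re s)" for s
    by (simp add: E_def Re_exp)
  have main: "norm (G s * exp (- of_real \<delta> * E s)) \<le> B + \<delta>" if \<delta>: "\<delta> > 0" for \<delta> :: real
  proof -
    \<comment> \<open>The exponent \<rho> may be negative. The nonnegative \<rho>' makes the power
      monotone in the base and dominates for bases at least 1.\<close>
    define \<rho>' where "\<rho>' = max \<rho> 0"
    have K: "K > 0" by (simp add: K_def)
    have "((\<lambda>t. \<bar>C\<bar> * exp ((K + t) powr \<rho>' + \<bar>D\<bar> * (K + t)) * exp (- \<delta> * (exp (\<eta> * t) * cos 1)))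
             \<longlongrightarrow> 0) at_top"
    proof -
      have lim: "filterlim (\<lambda>t. (K + t) powr \<rho>' + \<bar>D\<bar> * (K + t) + - \<delta> * (exp (\<eta> * t) * cos 1)) at_bot at_top"
      proof -
        have l1: "((\<lambda>t. (K + t) powr \<rho>' / exp (\<eta> * t)) \<longlongrightarrow> 0) at_top"
          using K \<eta> by real_asymp
        have l2: "((\<lambda>t. \<bar>D\<bar> * (K + t) / exp (\<eta> * t)) \<longlongrightarrow> 0) at_top"
          using K \<eta> by real_asymp
        have "((\<lambda>t. (K + t) powr \<rho>' / exp (\<eta> * t) + \<bar>D\<bar> * (K + t) / exp (\<eta> * t) + - \<delta> * cos 1)
               \<longlongrightarrow> 0 + 0 + - \<delta> * cos 1) at_top"
          by (intro tendsto_intros l1 l2)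
        moreover have "filterlim (\<lambda>t. exp (\<eta> * t)) at_top at_top"
          using \<eta> by real_asymp
        ultimately have "filterlim (\<lambda>t. ((K + t) powr \<rho>' / exp (\<eta> * t) + \<bar>D\<bar> * (K + t) / exp (\<eta> * t) + - \<delta> * cos 1)
            * exp (\<eta> * t)) at_bot at_top"
          using \<delta> cos1 by (intro filterlim_tendsto_neg_mult_at_bot) auto
        moreover have "((K + t) powr \<rho>' / exp (\<eta> * t) + \<bar>D\<bar> * (K + t) / exp (\<eta> * t) + - \<delta> * cos 1)
            * exp (\<eta> * t) = (K + t) powr \<rho>' + \<bar>D\<bar> * (K + t) + - \<delta> * (exp (\<eta> * t) * cos 1)" for t
          by (simp only: distrib_right) simp
        ultimately show ?thesis by simp
      qed
      have "((\<lambda>t. \<bar>C\<bar> * exp ((K + t) powr \<rho>' + \<bar>D\<bar> * (K + t) + - \<delta> * (exp (\<eta> * t) * cos 1)))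
             \<longlongrightarrow> \<bar>C\<bar> * 0) at_top"
        by (intro tendsto_intros filterlim_compose[OF exp_at_bot lim])
      then show ?thesis by (simp only: exp_add mult.assoc mult_zero_right)
    qed
    then have "eventually (\<lambda>t. \<bar>C\<bar> * exp ((K + t) powr \<rho>' + \<bar>D\<bar> * (K + t)) * exp (- \<delta> * (exp (\<eta> * t) * cos 1)) < \<delta>) at_top"
      using \<delta> by (rule order_tendstoD)
    then obtain T1 where T1: "\<And>t. t \<ge> T1 \<Longrightarrow>
        \<bar>C\<bar> * exp ((K + t) powr \<rho>' + \<bar>D\<bar> * (K + t)) * exp (- \<delta> * (exp (\<eta> * t) * cos 1)) < \<delta>"
      unfolding eventually_at_top_linorder by blast
    \<comment> \<open>Above \<open>T1\<close> the top edge contributes less than \<delta>, above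
      \<tau>' the growth bound applies, above \<open>Im s\<close> the rectangle contains s, and
      above 1 the norms on the top edge are at least 1.\<close>
    define T where "T = Max {T1, \<tau>', Im s, 1}"
    have T: "T \<ge> T1" "T \<ge> \<tau>'" "T \<ge> Im s" "T \<ge> 1" by (auto simp: T_def)
    have nE: "norm (exp (- of_real \<delta> * E z)) = exp (- \<delta> * (exp (\<eta> * Im z) * cos (\<eta> * Re z)))" for z
      by (simp add: ReE)
    have nE1: "norm (exp (- of_real \<delta> * E z)) \<le> exp (- \<delta> * (exp (\<eta> * Im z) * cos 1))"
      if "a \<le> Re z" "Re z \<le> b" for z
      unfolding nE using \<delta> cosge[OF that] by (simp add: mult_left_mono)
    have nE2: "norm (exp (- of_real \<delta> * E z)) \<le> 1" if "a \<le> Re z" "Re z \<le> b" for z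
      using nE1[OF that] \<delta> cos1 by (smt (verit) exp_gt_zero mult_neg_pos mult_pos_pos one_le_exp_iff exp_le_one_iff)
    let ?S = "cbox (Complex a \<tau>) (Complex b T)"
    have SU: "?S \<subseteq> U" using holo(3) by (auto simp: in_cbox_complex_iff)
    have hol: "(\<lambda>z. G z * exp (- of_real \<delta> * E z)) holomorphic_on U"
      unfolding E_def by (intro holomorphic_intros holo)
    show ?thesis
    proof (rule maximum_modulus_frontier[of "\<lambda>z. G z * exp (- of_real \<delta> * E z)" ?S _ s])
      show "(\<lambda>z. G z * exp (- of_real \<delta> * E z)) holomorphic_on interior ?S"
        using hol SU interior_subset by (blast intro: holomorphic_on_subset)
      show "continuous_on (closure ?S) (\<lambda>z. G z * exp (- of_real \<delta> * E z))"
        using hol SU by (simp add: holomorphic_on_imp_continuous_on holomorphic_on_subset)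
      show "bounded ?S" by simp
      show "s \<in> ?S" using s T by (auto simp: in_cbox_complex_iff)
      fix z assume "z \<in> frontier ?S"
      then have z: "a \<le> Re z" "Re z \<le> b" "\<tau> \<le> Im z" "Im z \<le> T"
        and zb: "Re z = a \<or> Re z = b \<or> Im z = \<tau> \<or> Im z = T"
        by (auto simp: frontier_def in_cbox_complex_iff in_box_complex_iff)
      show "norm (G z * exp (- of_real \<delta> * E z)) \<le> B + \<delta>"
      proof (cases "Im z = T")
        case False
        then have "norm (G z) \<le> B" using z zb by (intro bnd) auto
        then have "norm (G z) * norm (exp (- of_real \<delta> * E z)) \<le> B * 1"
          using nE2[OF z(1,2)] B0 by (intro mult_mono) auto
        then show ?thesis using \<delta> by (simp add: norm_mult)
      next
        case True
        have nz: "norm z \<le> K + T"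
          using cmod_le[of z] z True T by (auto simp: K_def)
        have nz1: "norm z \<ge> 1" using True T abs_Im_le_cmod[of z] by linarith
        have "norm z powr \<rho> \<le> norm z powr \<rho>'" using nz1 by (intro powr_mono) (auto simp: \<rho>'_def)
        also have "\<dots> \<le> (K + T) powr \<rho>'" using nz nz1 by (intro powr_mono2) (auto simp: \<rho>'_def)
        finally have p: "norm z powr \<rho> \<le> (K + T) powr \<rho>'" .
        have "D * norm z \<le> \<bar>D\<bar> * norm z" by (intro mult_right_mono) auto
        also have "\<dots> \<le> \<bar>D\<bar> * (K + T)" using nz by (intro mult_left_mono) auto
        finally have q: "D * norm z \<le> \<bar>D\<bar> * (K + T)" .
        have "norm (G z) \<le> C * exp (norm z powr \<rho> + D * norm z)"
          using z True T by (intro growth) auto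
        also have "\<dots> \<le> \<bar>C\<bar> * exp ((K + T) powr \<rho>' + \<bar>D\<bar> * (K + T))"
          using p q by (intro mult_mono) auto
        finally have "norm (G z) \<le> \<bar>C\<bar> * exp ((K + T) powr \<rho>' + \<bar>D\<bar> * (K + T))" .
        then have "norm (G z) * norm (exp (- of_real \<delta> * E z)) \<le>
            \<bar>C\<bar> * exp ((K + T) powr \<rho>' + \<bar>D\<bar> * (K + T)) * exp (- \<delta> * (exp (\<eta> * T) * cos 1))"
          using nE1[OF z(1,2)] True by (intro mult_mono) auto
        also have "\<dots> < \<delta>" by (rule T1[OF T(1)])
        finally show ?thesis using B0 by (simp add: norm_mult)
      qed
    qed
  qed
  \<comment> \<open>The height of the rectangle depended on \<delta>, but this bound at the fixed
    point s does not mention it, so \<delta> may tend to 0.\<close>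
  have "norm (G s) \<le> (B + \<delta>) * exp (\<delta> * Re (E s))" if "\<delta> > 0" for \<delta> :: real
  proof -
    have "norm (G s) * exp (- \<delta> * Re (E s)) \<le> B + \<delta>" using main[OF that] by (simp add: norm_mult)
    then show ?thesis by (simp add: exp_minus field_simps)
  qed
  then have ev: "eventually (\<lambda>\<delta>. norm (G s) \<le> (B + \<delta>) * exp (\<delta> * Re (E s))) (at_right 0)"
    by (simp add: eventually_at_right_less eventually_mono[OF eventually_at_right_less])
  have "((\<lambda>\<delta>. (B + \<delta>) * exp (\<delta> * Re (E s))) \<longlongrightarrow> (B + 0) * exp (0 * Re (E s))) (at_right 0)"
    by (intro tendsto_intros)
  from tendsto_lowerbound[OF this ev] show ?thesis by simp
qed

section \<open>Exponential decay of Gamma in vertical strips\<close>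

lemma norm_Gamma_le:
  assumes "Re z > 0" shows "norm (Gamma z) \<le> Gamma (Re z)"
proof -
  have A: "((\<lambda>t. of_real t powr (z - 1) / of_real (exp t)) has_integral Gamma z) {0..}"
    by (rule Gamma_integral_complex) fact
  have B: "((\<lambda>t. t powr (Re z - 1) / exp t) has_integral Gamma (Re z)) {0..}"
    using assms by (intro Gamma_integral_real)
  have "norm (integral {0..} (\<lambda>t. of_real t powr (z - 1) / of_real (exp t) :: complex))
      \<le> integral {0..} (\<lambda>t. t powr (Re z - 1) / exp t)"
  proof (rule integral_norm_bound_integral)
    fix t :: real assume "t \<in> {0..}"
    then show "norm (of_real t powr (z - 1) / of_real (exp t) :: complex) \<le> t powr (Re z - 1) / exp t"
      by (cases "t = 0") (simp_all add: norm_divide norm_powr_real_powr)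
  qed (use A B in blast)+
  then show ?thesis using A B by (simp add: integral_unique)
qed

text \<open>Each factor z + i of the Pochhammer product relating \<open>Gamma z\<close> to
  \<open>Gamma (z + n)\<close> has norm at least |Im z|. This carries bounds from the right
  half-plane to the left, away from the real axis.\<close>

lemma norm_Gamma_le_shift:
  assumes "\<bar>Im z\<bar> \<ge> h" "h > 0"
  shows "norm (Gamma z) \<le> norm (Gamma (z + of_nat n)) / h ^ n"
proof -
  have z: "z \<notin> \<int>\<^sub>\<le>\<^sub>0" using assms by (auto elim!: nonpos_Ints_cases)
  have "h ^ n = (\<Prod>i<n. h)" by simp
  also have "\<dots> \<le> (\<Prod>i<n. norm (z + of_nat i))"
  proof (intro prod_mono conjI)
    fix i
    show "h \<le> norm (z + of_nat i)" using assms abs_Im_le_cmod[of "z + of_nat i"] by simp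
  qed (use assms in auto)
  also have "\<dots> = norm (pochhammer z n)" by (simp add: pochhammer_prod prod_norm lessThan_atLeast0)
  finally have "h ^ n \<le> norm (pochhammer z n)" .
  moreover have "Gamma (z + of_nat n) = pochhammer z n * Gamma z"
    using pochhammer_Gamma[OF z, of n] Gamma_eq_zero_iff[of z] z by simp
  ultimately show ?thesis using assms
    by (simp add: pos_le_divide_eq norm_mult mult.commute[of _ "norm (Gamma z)"] mult_left_mono)
qed

lemma Gamma_bounded_strip:
  assumes "h > 0"
  obtains C where "\<And>z. \<bar>Re z\<bar> \<le> K \<Longrightarrow> \<bar>Im z\<bar> \<ge> h \<Longrightarrow> norm (Gamma z) \<le> C"
proof -
  \<comment> \<open>Shifting by n >= K + 1 moves the whole strip to real parts at least 1, where
    Euler's integral bounds |Gamma| by its values on the real axis.\<close>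
  define n where "n = nat \<lceil>K + 1\<rceil>"
  have n: "K + 1 \<le> real n" unfolding n_def by (rule real_nat_ceiling_ge)
  have "continuous_on {1..K + real n} (Gamma :: real \<Rightarrow> real)"
    by (intro continuous_on_Gamma) (auto elim!: nonpos_Ints_cases)
  then have "bounded (Gamma ` {1..K + real n})"
    by (intro compact_imp_bounded compact_continuous_image) auto
  then obtain C where C: "\<And>x. 1 \<le> x \<Longrightarrow> x \<le> K + real n \<Longrightarrow> \<bar>Gamma x\<bar> \<le> C"
    unfolding bounded_iff ball_simps real_norm_def by (metis atLeastAtMost_iff)
  show ?thesis
  proof (rule that)
    fix z assume z: "\<bar>Re z\<bar> \<le> K" "\<bar>Im z\<bar> \<ge> h"
    have "norm (Gamma z) \<le> norm (Gamma (z + of_nat n)) / h ^ n"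
      using z(2) assms by (rule norm_Gamma_le_shift)
    also have "norm (Gamma (z + of_nat n)) \<le> Gamma (Re z + real n)"
      using norm_Gamma_le[of "z + of_nat n"] z n by simp
    also have "\<dots> \<le> C" using C[of "Re z + real n"] z n by auto
    finally show "norm (Gamma z) \<le> C / h ^ n" using assms by (simp add: divide_right_mono)
  qed
qed

text \<open>Serves for division: by the sine in the reflection formula, and by \<open>trig\<close>
  when \<open>P\<close> is recovered from \<open>M\<close>.\<close>

lemma norm_sin_ge:
  assumes "\<bar>Im z\<bar> \<ge> 1" shows "norm (sin z) \<ge> exp \<bar>Im z\<bar> / 4"
proof -
  have *: "norm (sin z) \<ge> exp \<bar>Im z\<bar> / 4" if "Im z \<ge> 1" for z
  proof -
    have "sin z = (exp (\<i> * z) - exp (- (\<i> * z))) / (2 * \<i>)" by (simp add: sin_exp_eq)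
    then have "norm (sin z) = norm (exp (\<i> * z) - exp (- (\<i> * z))) / 2" by (simp only: norm_divide norm_mult) simp
    also have "\<dots> \<ge> (norm (exp (- (\<i> * z))) - norm (exp (\<i> * z))) / 2"
      using norm_triangle_ineq2[of "exp (- (\<i> * z))" "exp (\<i> * z)"]
      by (simp add: norm_minus_commute)
    also have "(norm (exp (- (\<i> * z))) - norm (exp (\<i> * z))) = exp (Im z) - exp (- Im z)" by simp
    finally have 1: "norm (sin z) \<ge> (exp (Im z) - exp (- Im z)) / 2" .
    have "exp (Im z) \<ge> 2" using exp_ge_add_one_self[of "Im z"] that by linarith
    moreover have "exp (- Im z) \<le> 1" using that by simp
    ultimately have "exp (- Im z) \<le> exp (Im z) / 2" by linarith
    with 1 show ?thesis using that by auto
  qed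
  show ?thesis using *[of z] *[of "- z"] assms by (cases "Im z \<ge> 0") auto
qed

text \<open>Absorbs a linear factor at the price of an arbitrarily small loss in the exponential
  rate.\<close>

lemma linear_le_exp:
  assumes "(\<epsilon> :: real) > 0" "x \<ge> 0" shows "x \<le> exp (\<epsilon> * x) / \<epsilon>"
proof -
  have "\<epsilon> * x \<le> exp (\<epsilon> * x)" using exp_ge_add_one_self[of "\<epsilon> * x"] by linarith
  then show ?thesis using assms by (simp add: pos_le_divide_eq mult.commute)
qed

text \<open>Since 1 + it and 1 - it are conjugate, |Gamma(1 + it)|^2 = Gamma(1 + it) Gamma(1 - it),
  which reflection evaluates as pi t / sinh(pi t). The slack \<epsilon> = pi - 2 b absorbs the
  factor t.\<close>

lemma Gamma_decay_line_one:
  assumes "0 \<le> b" "b < pi / 2"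
  obtains C where "\<And>t. norm (Gamma (Complex 1 t)) \<le> C * exp (- b * \<bar>t\<bar>)"
proof -
  define \<epsilon> where "\<epsilon> = pi - 2 * b"
  have \<epsilon>: "\<epsilon> > 0" using assms by (simp add: \<epsilon>_def)
  define C where "C = max (exp b) (sqrt (4 * pi / \<epsilon>))"
  have "norm (Gamma (Complex 1 t)) \<le> C * exp (- b * \<bar>t\<bar>)" for t
  proof (cases "\<bar>t\<bar> \<ge> 1")
    case False
    have "norm (Gamma (Complex 1 t)) \<le> 1" using norm_Gamma_le[of "Complex 1 t"] by simp
    also have "1 \<le> exp b * exp (- b * \<bar>t\<bar>)"
    proof -
      have "b * \<bar>t\<bar> \<le> b * 1" using False assms by (intro mult_left_mono) auto
      then show ?thesis by (simp flip: exp_add)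
    qed
    also have "\<dots> \<le> C * exp (- b * \<bar>t\<bar>)" by (intro mult_right_mono) (auto simp: C_def)
    finally show ?thesis .
  next
    case True
    let ?w = "\<i> * of_real t"
    have w: "Complex 1 t = ?w + 1" "1 - ?w = cnj (Complex 1 t)" by (simp_all add: complex_eq_iff)
    have "norm (Gamma (Complex 1 t)) ^ 2 = norm (Gamma (?w + 1) * Gamma (1 - ?w))"
      unfolding w(2) cnj_Gamma[symmetric] by (simp add: norm_mult power2_eq_square w(1))
    also have "Gamma (?w + 1) = ?w * Gamma ?w"
      using True by (intro Gamma_plus1) (auto elim!: nonpos_Ints_cases simp: complex_eq_iff)
    also have "?w * Gamma ?w * Gamma (1 - ?w) = ?w * (of_real pi / sin (of_real pi * ?w))"
      using Gamma_reflection_complex[of ?w] by (simp add: mult.assoc)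
    also have "norm \<dots> = \<bar>t\<bar> * pi / norm (sin (of_real pi * ?w))"
      by (simp add: norm_mult norm_divide)
    also have "\<dots> \<le> \<bar>t\<bar> * pi / (exp (pi * \<bar>t\<bar>) / 4)"
    proof (intro divide_left_mono)
      have "1 \<le> pi * \<bar>t\<bar>" using True pi_gt3 by (smt (verit) mult_le_cancel_left1)
      then show "exp (pi * \<bar>t\<bar>) / 4 \<le> norm (sin (of_real pi * ?w))"
        using norm_sin_ge[of "of_real pi * ?w"] by (simp add: abs_mult)
      then show "0 < norm (sin (of_real pi * ?w)) * (exp (pi * \<bar>t\<bar>) / 4)"
        by (smt (verit) exp_gt_zero mult_pos_pos zero_less_divide_iff)
    qed simp
    also have "\<dots> = 4 * pi * \<bar>t\<bar> * exp (- pi * \<bar>t\<bar>)" by (simp add: exp_minus field_simps)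
    also have "\<dots> \<le> 4 * pi * (exp (\<epsilon> * \<bar>t\<bar>) / \<epsilon>) * exp (- pi * \<bar>t\<bar>)"
      using linear_le_exp[OF \<epsilon>, of "\<bar>t\<bar>"] by (intro mult_right_mono mult_left_mono) auto
    also have "\<dots> = 4 * pi / \<epsilon> * exp (\<epsilon> * \<bar>t\<bar> + - pi * \<bar>t\<bar>)" by (simp only: exp_add) simp
    also have "\<epsilon> * \<bar>t\<bar> + - pi * \<bar>t\<bar> = - b * \<bar>t\<bar> + - b * \<bar>t\<bar>" by (simp add: \<epsilon>_def algebra_simps)
    also have "4 * pi / \<epsilon> * exp \<dots> = (sqrt (4 * pi / \<epsilon>) * exp (- b * \<bar>t\<bar>)) ^ 2"
      unfolding exp_add using \<epsilon> by (simp add: power_mult_distrib power2_eq_square[of "exp _"])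
    finally have "norm (Gamma (Complex 1 t)) \<le> sqrt (4 * pi / \<epsilon>) * exp (- b * \<bar>t\<bar>)"
      by (rule power2_le_imp_le) (simp add: \<epsilon> less_imp_le)
    also have "\<dots> \<le> C * exp (- b * \<bar>t\<bar>)" by (intro mult_right_mono) (auto simp: C_def)
    finally show ?thesis .
  qed
  then show ?thesis by (rule that)
qed

text \<open>Each use of Gamma(s + 1) = s Gamma(s) costs a linear factor and hence part of the rate,
  so the induction has to quantify over all b.\<close>

lemma Gamma_decay_line:
  assumes "0 \<le> b" "b < pi / 2"
  obtains C where "\<And>t. norm (Gamma (Complex (real (Suc n)) t)) \<le> C * exp (- b * \<bar>t\<bar>)"
proof -
  have "\<exists>C. \<forall>t. norm (Gamma (Complex (real (Suc n)) t)) \<le> C * exp (- b * \<bar>t\<bar>)"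
    using assms
  proof (induction n arbitrary: b)
    case 0
    then show ?case using Gamma_decay_line_one[of b] by (metis One_nat_def of_nat_1)
  next
    case (Suc n)
    define \<epsilon> where "\<epsilon> = (pi / 2 - b) / 2"
    have \<epsilon>: "\<epsilon> > 0" "0 \<le> b + \<epsilon>" "b + \<epsilon> < pi / 2" using Suc.prems by (auto simp: \<epsilon>_def field_simps)
    obtain C where C: "\<And>t. norm (Gamma (Complex (real (Suc n)) t)) \<le> C * exp (- (b + \<epsilon>) * \<bar>t\<bar>)"
      using Suc.IH[OF \<epsilon>(2,3)] by blast
    have C0: "C \<ge> 0" using C[of 0] by (smt (verit) norm_ge_zero mult_neg_pos exp_gt_zero)
    have "norm (Gamma (Complex (real (Suc (Suc n))) t)) \<le> (real (Suc n) + 1 / \<epsilon>) * C * exp (- b * \<bar>t\<bar>)" for t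
    proof -
      have e: "Complex (real (Suc (Suc n))) t = Complex (real (Suc n)) t + 1"
        by (simp add: complex_eq_iff)
      have "Complex (real (Suc n)) t \<notin> \<int>\<^sub>\<le>\<^sub>0" by (auto elim!: nonpos_Ints_cases simp: complex_eq_iff)
      then have "norm (Gamma (Complex (real (Suc (Suc n))) t)) =
          norm (Complex (real (Suc n)) t) * norm (Gamma (Complex (real (Suc n)) t))"
        unfolding e by (subst Gamma_plus1) (auto simp: norm_mult)
      also have "\<dots> \<le> (real (Suc n) + \<bar>t\<bar>) * (C * exp (- (b + \<epsilon>) * \<bar>t\<bar>))"
        using cmod_le[of "Complex (real (Suc n)) t"] by (intro mult_mono C) auto
      also have "\<dots> \<le> ((real (Suc n) + 1 / \<epsilon>) * exp (\<epsilon> * \<bar>t\<bar>)) * (C * exp (- (b + \<epsilon>) * \<bar>t\<bar>))"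
      proof (rule mult_right_mono)
        have "real (Suc n) * 1 \<le> real (Suc n) * exp (\<epsilon> * \<bar>t\<bar>)"
          using \<epsilon> by (intro mult_left_mono) auto
        then have "real (Suc n) \<le> real (Suc n) * exp (\<epsilon> * \<bar>t\<bar>)" by (simp only: mult_1_right)
        then show "real (Suc n) + \<bar>t\<bar> \<le> (real (Suc n) + 1 / \<epsilon>) * exp (\<epsilon> * \<bar>t\<bar>)"
          using linear_le_exp[OF \<epsilon>(1), of "\<bar>t\<bar>"] unfolding distrib_right by (simp only: add_mono abs_ge_zero times_divide_eq_left mult_1_left)
      qed (use C0 in auto)
      also have "\<dots> = (real (Suc n) + 1 / \<epsilon>) * C * (exp (\<epsilon> * \<bar>t\<bar>) * exp (- (b + \<epsilon>) * \<bar>t\<bar>))"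
        by (simp add: mult_ac)
      also have "exp (\<epsilon> * \<bar>t\<bar>) * exp (- (b + \<epsilon>) * \<bar>t\<bar>) = exp (- b * \<bar>t\<bar>)"
        by (simp flip: exp_add add: algebra_simps)
      finally show ?thesis .
    qed
    then show ?case by blast
  qed
  then show ?thesis using that by blast
qed

text \<open>Decay on the two vertical edges of a strip in the right half-plane spreads to its
  interior by Phragmen-Lindelof; conjugation gives negative imaginary parts, and the Pochhammer
  shift gives real parts below 1.\<close>

lemma Gamma_decay_strip:
  assumes "0 \<le> b" "b < pi / 2"
  obtains C where "\<And>s. \<bar>Re s\<bar> \<le> K \<Longrightarrow> \<bar>Im s\<bar> \<ge> 1 \<Longrightarrow> norm (Gamma s) \<le> C * exp (- b * \<bar>Im s\<bar>)"
proof -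
  define n where "n = nat \<lceil>K + 1\<rceil>"
  have n: "K + 1 \<le> real n" unfolding n_def by (rule real_nat_ceiling_ge)
  \<comment> \<open>For |Re s| <= K the shifted point s + n has real part between 1 and 2 n, so it
    lies between the two lines.\<close>
  define X where "X = real (Suc (2 * n))"
  obtain C1 where C1: "\<And>t. norm (Gamma (Complex (real (Suc 0)) t)) \<le> C1 * exp (- b * \<bar>t\<bar>)"
    using Gamma_decay_line[OF assms, of 0] by blast
  obtain C2 where C2: "\<And>t. norm (Gamma (Complex X t)) \<le> C2 * exp (- b * \<bar>t\<bar>)"
    using Gamma_decay_line[OF assms, of "2 * n"] unfolding X_def by blast
  obtain C3 where C3: "\<And>s. \<bar>Re s\<bar> \<le> X \<Longrightarrow> \<bar>Im s\<bar> \<ge> 1 \<Longrightarrow> norm (Gamma s) \<le> C3"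
    using Gamma_bounded_strip[of 1] by (metis zero_less_one)
  define C where "C = Max {C1, C2, C3 * exp b}"
  have CC: "C1 \<le> C" "C2 \<le> C" "C3 * exp b \<le> C" by (auto simp: C_def)
  have up: "norm (Gamma s) \<le> C * exp (- b * Im s)" if s: "1 \<le> Re s" "Re s \<le> X" "1 \<le> Im s" for s
  proof -
    \<comment> \<open>The twist has norm exp(b Im s), which turns decay at rate b into boundedness,
      the form in which Phragmen-Lindelof applies.\<close>
    let ?G = "\<lambda>s. Gamma s * exp (- \<i> * of_real b * s)"
    have nG: "norm (?G z) = norm (Gamma z) * exp (b * Im z)" for z by (simp add: norm_mult)
    have conv: "norm (?G z) \<le> C'" if "norm (Gamma z) \<le> C' * exp (- b * Im z)" for z C'
    proof -
      have "norm (?G z) \<le> C' * exp (- b * Im z) * exp (b * Im z)"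
        unfolding nG using that by (rule mult_right_mono) simp
      also have "C' * exp (- b * Im z) * exp (b * Im z) = C'" by (simp add: exp_minus)
      finally show ?thesis .
    qed
    have "norm (?G s) \<le> C"
    proof (rule phragmen_lindelof_half_strip[where G = ?G and s = s and a = 1 and b = X and \<tau> = 1 and U = "{z. Re z > 0}"
          and \<tau>' = 1 and C = C3 and \<rho> = 0 and D = b])
      show "?G holomorphic_on {z. Re z > 0}"
        by (intro holomorphic_intros) (auto elim!: nonpos_Ints_cases)
      show "open {z. Re z > 0}" by (rule open_halfspace_Re_gt)
      fix z assume z: "1 \<le> Re z" "Re z \<le> X" "1 \<le> Im z"
      show "norm (?G z) \<le> C" if "Re z = 1 \<or> Re z = X \<or> Im z = 1"
        using that
      proof (elim disjE)
        assume "Re z = 1"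
        then have "Complex 1 (Im z) = z" by (simp add: complex_eq_iff)
        then have "norm (Gamma z) \<le> C1 * exp (- b * Im z)" using C1[of "Im z"] z by simp
        then show ?thesis using conv CC order_trans by blast
      next
        assume "Re z = X"
        then have "Complex X (Im z) = z" by (simp add: complex_eq_iff)
        then have "norm (Gamma z) \<le> C2 * exp (- b * Im z)" using C2[of "Im z"] z by simp
        then show ?thesis using conv CC order_trans by blast
      next
        assume "Im z = 1"
        moreover have "norm (Gamma z) \<le> C3" using z by (intro C3) auto
        ultimately have "norm (?G z) \<le> C3 * exp b"
          unfolding nG by (intro mult_mono) (auto intro: order_trans[OF norm_ge_zero])
        then show ?thesis using CC(3) by (rule order_trans)
      qed
      have "norm (Gamma z) \<le> C3" using z by (intro C3) auto
      moreover have "exp (b * Im z) \<le> exp (norm z powr 0 + b * norm z)"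
        using mult_left_mono[OF order_trans[OF abs_ge_self abs_Im_le_cmod[of z]] assms(1)]
        by (simp add: add_increasing)
      ultimately show "norm (?G z) \<le> C3 * exp (norm z powr 0 + b * norm z)"
        unfolding nG by (intro mult_mono) (auto intro: order_trans[OF norm_ge_zero])
    qed (use s in auto)
    then show ?thesis unfolding nG by (simp add: exp_minus field_simps)
  qed
  have both: "norm (Gamma s) \<le> C * exp (- b * \<bar>Im s\<bar>)" if s: "1 \<le> Re s" "Re s \<le> X" "1 \<le> \<bar>Im s\<bar>" for s
  proof (cases "Im s \<ge> 0")
    case True
    then show ?thesis using up[of s] s by simp
  next
    case False
    then show ?thesis using up[of "cnj s"] s by (simp add: cnj_Gamma[symmetric])
  qed
  show ?thesis
  proof (rule that)
    fix s assume s: "\<bar>Re s\<bar> \<le> K" "1 \<le> \<bar>Im s\<bar>"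
    have "norm (Gamma s) \<le> norm (Gamma (s + of_nat n)) / 1 ^ n"
      using s by (intro norm_Gamma_le_shift) auto
    also have "\<dots> \<le> C * exp (- b * \<bar>Im s\<bar>)"
      using both[of "s + of_nat n"] s n by (auto simp: X_def)
    finally show "norm (Gamma s) \<le> C * exp (- b * \<bar>Im s\<bar>)" .
  qed
qed

section \<open>Integrals along vertical lines\<close>

lemma integrable_exp_neg_abs:
  assumes "\<delta> > 0" shows "integrable lborel (\<lambda>t :: real. exp (- \<delta> * \<bar>t\<bar>))"
proof -
  have "(\<lambda>t. exp (- \<delta> * t)) absolutely_integrable_on {0..}"
    using integrable_on_exp_minus_to_infinity[OF assms, of 0]
    by (intro nonnegative_absolutely_integrable_1) auto
  then have pos: "integrable lborel (\<lambda>t. indicator {0..} t *\<^sub>R exp (- \<delta> * t))"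
    unfolding set_integrable_def by (subst (asm) integrable_completion) auto
  have neg: "integrable lborel (\<lambda>t. indicator {0..} (- t) *\<^sub>R exp (- \<delta> * (- t)))"
    using lborel_integrable_real_affine[OF pos, of "-1" 0] by simp
  have "integrable lborel (\<lambda>t. indicator {0..} t *\<^sub>R exp (- \<delta> * t) + indicator {0..} (- t) *\<^sub>R exp (- \<delta> * (- t)))"
    using pos neg by (rule Bochner_Integration.integrable_add)
  then show ?thesis
    by (rule Bochner_Integration.integrable_bound) (auto simp: indicator_def)
qed

lemma integrable_exp_decay:
  fixes p :: "real \<Rightarrow> complex"
  assumes "\<delta> > 0" "continuous_on UNIV p" "\<And>t. norm (p t) \<le> C * exp (- \<delta> * \<bar>t\<bar>)"
  shows "integrable lborel p"
proof (rule Bochner_Integration.integrable_bound)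
  show "integrable lborel (\<lambda>t. C * exp (- \<delta> * \<bar>t\<bar>))"
    using integrable_exp_neg_abs[OF assms(1)] by simp
  show "p \<in> borel_measurable lborel"
    using borel_measurable_continuous_onI[OF assms(2)] by simp
  show "AE t in lborel. norm (p t) \<le> norm (C * exp (- \<delta> * \<bar>t\<bar>))"
    using assms(3) by (intro AE_I2) (simp add: order_trans[OF _ abs_ge_self])
qed

text \<open>The strip estimates start at |Im s| = 1, since poles may lie on the real axis. On a line
  avoiding them, compactness fills the gap.\<close>

lemma exp_decay_extend:
  fixes p :: "real \<Rightarrow> complex"
  assumes "continuous_on UNIV p" "\<And>t. \<bar>t\<bar> \<ge> 1 \<Longrightarrow> norm (p t) \<le> C * exp (- b * \<bar>t\<bar>)" "b \<ge> 0"
  obtains C' where "\<And>t. norm (p t) \<le> C' * exp (- b * \<bar>t\<bar>)"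
proof -
  have "bounded (p ` {-1..1})"
    using assms(1) by (intro compact_imp_bounded compact_continuous_image)
      (auto intro: continuous_on_subset)
  then obtain D where "\<forall>x\<in>p ` {-1..1}. norm x \<le> D" unfolding bounded_iff by blast
  then have D: "norm (p t) \<le> D" if "\<bar>t\<bar> \<le> 1" for t using that by (auto simp: abs_le_iff)
  have D0: "D \<ge> 0" using order_trans[OF norm_ge_zero D[of 0]] by simp
  show ?thesis
  proof (rule that)
    fix t
    show "norm (p t) \<le> (max C (D * exp b)) * exp (- b * \<bar>t\<bar>)"
    proof (cases "\<bar>t\<bar> \<ge> 1")
      case True
      have "norm (p t) \<le> C * exp (- b * \<bar>t\<bar>)" by (rule assms(2)[OF True])
      also have "\<dots> \<le> (max C (D * exp b)) * exp (- b * \<bar>t\<bar>)" by (intro mult_right_mono) auto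
      finally show ?thesis .
    next
      case False
      have "b * \<bar>t\<bar> \<le> b * 1" using False assms(3) by (intro mult_left_mono) auto
      then have "1 \<le> exp b * exp (- b * \<bar>t\<bar>)" by (simp flip: exp_add)
      then have "D * 1 \<le> D * (exp b * exp (- b * \<bar>t\<bar>))" using D0 by (intro mult_left_mono) auto
      moreover have "norm (p t) \<le> D" using False by (intro D) auto
      ultimately have "norm (p t) \<le> D * exp b * exp (- b * \<bar>t\<bar>)" by simp
      also have "\<dots> \<le> (max C (D * exp b)) * exp (- b * \<bar>t\<bar>)" by (intro mult_right_mono) auto
      finally show ?thesis .
    qed
  qed
qed

section \<open>Moving vertical lines of integration\<close>

lemma tendsto_integral_symmetric_interval:
  fixes p :: "real \<Rightarrow> complex"
  assumes "integrable lborel p"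
  shows "(\<lambda>n. integral {- real n..real n} p) \<longlonglongrightarrow> (LINT t|lborel. p t)"
proof -
  have m[measurable]: "p \<in> borel_measurable lborel" using assms by simp
  have "(\<lambda>n. LINT t|lborel. indicator {- real n..real n} t *\<^sub>R p t) \<longlonglongrightarrow> (LINT t|lborel. p t)"
  proof (rule integral_dominated_convergence[where w = "\<lambda>t. norm (p t)"])
    show "AE t in lborel. (\<lambda>n. indicator {- real n..real n} t *\<^sub>R p t) \<longlonglongrightarrow> p t"
    proof (intro AE_I2 tendsto_eventually)
      fix t :: real
      show "eventually (\<lambda>n. indicator {- real n..real n} t *\<^sub>R p t = p t) sequentially"
        using eventually_ge_at_top[of "nat \<lceil>\<bar>t\<bar>\<rceil>"]
        by eventually_elim (auto simp: indicator_def abs_le_iff nat_le_iff ceiling_le_iff)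
    qed
    show "AE t in lborel. norm (indicator {- real n..real n} t *\<^sub>R p t) \<le> norm (p t)" for n
      by (intro AE_I2) (auto simp: indicator_def)
  qed (use assms in auto)
  moreover have "(LINT t|lborel. indicator {- real n..real n} t *\<^sub>R p t) = integral {- real n..real n} p" for n
  proof -
    have "set_integrable lborel {- real n..real n} p"
      unfolding set_integrable_def using assms by (intro integrable_mult_indicator) auto
    then show ?thesis
      using set_borel_integral_eq_integral(2) unfolding set_lebesgue_integral_def by blast
  qed
  ultimately show ?thesis by simp
qed

text \<open>The continuity domain leaves out the inside of the rectangle of height \<open>2\<close>, where
  \<open>F\<close> may have a pole.\<close>
lemma vertical_line_shift:
  fixes F :: "complex \<Rightarrow> complex"
  assumes ab: "a < b" and \<delta>: "\<delta> > 0"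
    and cont: "continuous_on {s. a \<le> Re s \<and> Re s \<le> b \<and> (Re s = a \<or> Re s = b \<or> \<bar>Im s\<bar> \<ge> 1)} F"
    and bnd: "\<And>s. a \<le> Re s \<Longrightarrow> Re s \<le> b \<Longrightarrow> \<bar>Im s\<bar> \<ge> 1 \<Longrightarrow> norm (F s) \<le> C * exp (- \<delta> * \<bar>Im s\<bar>)"
    and rect: "\<And>T. T \<ge> 1 \<Longrightarrow> contour_integral (rectpath (Complex a (- T)) (Complex b T)) F = R"
  shows "\<i> * (LINT t|lborel. F (Complex b t)) - \<i> * (LINT t|lborel. F (Complex a t)) = R"
proof -
  let ?X = "{s. a \<le> Re s \<and> Re s \<le> b \<and> (Re s = a \<or> Re s = b \<or> \<bar>Im s\<bar> \<ge> 1)}"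
  have line: "integrable lborel (\<lambda>t. F (Complex x t))" if x: "x = a \<or> x = b" for x
  proof -
    have c: "continuous_on UNIV (\<lambda>t. F (Complex x t))"
      using ab x by (intro continuous_on_compose2[OF cont]) (auto intro!: continuous_intros)
    have d: "norm (F (Complex x t)) \<le> C * exp (- \<delta> * \<bar>t\<bar>)" if "\<bar>t\<bar> \<ge> 1" for t
      using bnd[of "Complex x t"] that x ab by auto
    obtain C' where "\<And>t. norm (F (Complex x t)) \<le> C' * exp (- \<delta> * \<bar>t\<bar>)"
      using exp_decay_extend[OF c d] \<delta> by (metis less_imp_le)
    then show ?thesis using c \<delta> by (intro integrable_exp_decay)
  qed
  \<comment> \<open>What is left of the rectangle integral R after removing its vertical sides, that
    is, the two horizontal edges.\<close>
  define e where "e n = R - (\<i> * integral {- real n..real n} (\<lambda>t. F (Complex b t))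
      - \<i> * integral {- real n..real n} (\<lambda>t. F (Complex a t)))" for n
  have e: "norm (e n) \<le> 2 * (C * exp (- \<delta> * real n) * (b - a))" if n: "n \<ge> 1" for n
  proof -
    let ?a1 = "Complex a (- real n)" and ?a2 = "Complex b (- real n)"
    let ?a3 = "Complex b (real n)" and ?a4 = "Complex a (real n)"
    have seg: "closed_segment ?a1 ?a2 \<subseteq> ?X" "closed_segment ?a2 ?a3 \<subseteq> ?X"
      "closed_segment ?a3 ?a4 \<subseteq> ?X" "closed_segment ?a4 ?a1 \<subseteq> ?X" "closed_segment ?a1 ?a4 \<subseteq> ?X"
      using ab n by (auto simp: closed_segment_same_Re closed_segment_same_Im closed_segment_eq_real_ivl)
    have ci: "F contour_integrable_on linepath ?a1 ?a2" "F contour_integrable_on linepath ?a2 ?a3"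
      "F contour_integrable_on linepath ?a3 ?a4" "F contour_integrable_on linepath ?a4 ?a1"
      "F contour_integrable_on linepath ?a1 ?a4"
      using seg by (auto intro!: contour_integrable_continuous_linepath continuous_on_subset[OF cont])
    have "rectpath ?a1 ?a3 = linepath ?a1 ?a2 +++ linepath ?a2 ?a3 +++ linepath ?a3 ?a4 +++ linepath ?a4 ?a1"
      by (simp add: rectpath_def Let_def)
    then have "R = contour_integral (linepath ?a1 ?a2) F + contour_integral (linepath ?a2 ?a3) F
        + contour_integral (linepath ?a3 ?a4) F + contour_integral (linepath ?a4 ?a1) F"
      using rect[of "real n"] n ci by (simp add: contour_integrable_joinI valid_path_join add.assoc)
    also have "contour_integral (linepath ?a4 ?a1) F = - contour_integral (linepath ?a1 ?a4) F"
      using seg(4) by (intro contour_integral_reverse_linepath continuous_on_subset[OF cont])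
    also have "contour_integral (linepath ?a1 ?a4) F = \<i> * integral {- real n..real n} (\<lambda>t. F (Complex a t))"
      using n by (intro contour_integral_linepath_same_Re) auto
    also have "contour_integral (linepath ?a2 ?a3) F = \<i> * integral {- real n..real n} (\<lambda>t. F (Complex b t))"
      using n by (intro contour_integral_linepath_same_Re) auto
    finally have en: "e n = contour_integral (linepath ?a1 ?a2) F + contour_integral (linepath ?a3 ?a4) F"
      by (simp add: e_def)
    have C0: "0 \<le> C * exp (- \<delta> * real n)"
      using bnd[of ?a1] ab n by (auto intro: order_trans[OF norm_ge_zero])
    have "norm (contour_integral (linepath ?a1 ?a2) F) \<le> C * exp (- \<delta> * real n) * norm (?a2 - ?a1)"
    proof (intro contour_integral_bound_linepath ci C0)
      fix z assume "z \<in> closed_segment ?a1 ?a2"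
      then have "Im z = - real n" "a \<le> Re z" "Re z \<le> b"
        using ab by (auto simp: closed_segment_same_Im closed_segment_eq_real_ivl)
      then show "norm (F z) \<le> C * exp (- \<delta> * real n)" using bnd[of z] n by simp
    qed
    moreover have "norm (contour_integral (linepath ?a3 ?a4) F) \<le> C * exp (- \<delta> * real n) * norm (?a4 - ?a3)"
    proof (intro contour_integral_bound_linepath ci C0)
      fix z assume "z \<in> closed_segment ?a3 ?a4"
      then have "Im z = real n" "a \<le> Re z" "Re z \<le> b"
        using ab by (auto simp: closed_segment_same_Im closed_segment_eq_real_ivl)
      then show "norm (F z) \<le> C * exp (- \<delta> * real n)" using bnd[of z] n by simp
    qed
    moreover have "norm (?a2 - ?a1) = b - a" "norm (?a4 - ?a3) = b - a"
      using ab by (simp_all add: cmod_def)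
    ultimately show ?thesis
      unfolding en by (intro norm_triangle_le) simp
  qed
  have "(\<lambda>n. 2 * (C * exp (- \<delta> * real n) * (b - a))) \<longlonglongrightarrow> 0"
    using \<delta> by real_asymp
  then have "e \<longlonglongrightarrow> 0"
    by (rule Lim_null_comparison[rotated]) (use e eventually_sequentially in blast)
  moreover have "e \<longlonglongrightarrow> R - (\<i> * (LINT t|lborel. F (Complex b t)) - \<i> * (LINT t|lborel. F (Complex a t)))"
    unfolding e_def by (intro tendsto_intros tendsto_integral_symmetric_interval line) auto
  ultimately have "0 = R - (\<i> * (LINT t|lborel. F (Complex b t)) - \<i> * (LINT t|lborel. F (Complex a t)))"
    by (rule LIMSEQ_unique)
  then show ?thesis by (metis eq_iff_diff_eq_0)
qed

lemma vertical_line_shift_holomorphic: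
  fixes F :: "complex \<Rightarrow> complex"
  assumes ab: "a < b" and \<delta>: "\<delta> > 0"
    and S: "F holomorphic_on S" "convex S" "{s. a \<le> Re s \<and> Re s \<le> b} \<subseteq> S"
    and bnd: "\<And>s. a \<le> Re s \<Longrightarrow> Re s \<le> b \<Longrightarrow> \<bar>Im s\<bar> \<ge> 1 \<Longrightarrow> norm (F s) \<le> C * exp (- \<delta> * \<bar>Im s\<bar>)"
  shows "(LINT t|lborel. F (Complex b t)) = (LINT t|lborel. F (Complex a t))"
proof -
  have "\<i> * (LINT t|lborel. F (Complex b t)) - \<i> * (LINT t|lborel. F (Complex a t)) = 0"
  proof (rule vertical_line_shift[OF ab \<delta> _ bnd])
    show "continuous_on {s. a \<le> Re s \<and> Re s \<le> b \<and> (Re s = a \<or> Re s = b \<or> \<bar>Im s\<bar> \<ge> 1)} F"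
      using S(3) by (intro continuous_on_subset[OF holomorphic_on_imp_continuous_on[OF S(1)]]) auto
    fix T :: real assume T: "T \<ge> 1"
    have "path_image (rectpath (Complex a (- T)) (Complex b T)) \<subseteq> cbox (Complex a (- T)) (Complex b T)"
      using ab T by (intro path_image_rectpath_subset_cbox) auto
    also have "\<dots> \<subseteq> S" using S(3) by (auto simp: in_cbox_complex_iff)
    finally have "(F has_contour_integral 0) (rectpath (Complex a (- T)) (Complex b T))"
      using S by (intro Cauchy_theorem_convex_simple) auto
    then show "contour_integral (rectpath (Complex a (- T)) (Complex b T)) F = 0"
      by (rule contour_integral_unique)
  qed auto
  then show ?thesis by simp
qed

text \<open>Writing the integrand as F(s)/s lets Cauchy's integral formula supply the residue F(0)
  of the simple pole.\<close>

lemma vertical_line_shift_residue: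
  fixes F :: "complex \<Rightarrow> complex"
  assumes ab: "a < 0" "0 < b" and \<delta>: "\<delta> > 0"
    and S: "F holomorphic_on S" "convex S" "open S" "{s. a \<le> Re s \<and> Re s \<le> b} \<subseteq> S"
    and bnd: "\<And>s. a \<le> Re s \<Longrightarrow> Re s \<le> b \<Longrightarrow> \<bar>Im s\<bar> \<ge> 1 \<Longrightarrow> norm (F s / s) \<le> C * exp (- \<delta> * \<bar>Im s\<bar>)"
  shows "(LINT t|lborel. F (Complex b t) / Complex b t)
       = (LINT t|lborel. F (Complex a t) / Complex a t) + 2 * of_real pi * F 0"
proof -
  have "\<i> * (LINT t|lborel. F (Complex b t) / Complex b t) - \<i> * (LINT t|lborel. F (Complex a t) / Complex a t)
      = 2 * of_real pi * \<i> * F 0"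
  proof (rule vertical_line_shift[where F = "\<lambda>s. F s / s", OF _ \<delta> _ bnd])
    show "a < b" using ab by simp
    show "continuous_on {s. a \<le> Re s \<and> Re s \<le> b \<and> (Re s = a \<or> Re s = b \<or> \<bar>Im s\<bar> \<ge> 1)} (\<lambda>s. F s / s)"
      using S(4) ab
      by (intro continuous_intros continuous_on_subset[OF holomorphic_on_imp_continuous_on[OF S(1)]]) auto
    fix T :: real assume T: "T \<ge> 1"
    let ?g = "rectpath (Complex a (- T)) (Complex b T)"
    have sub: "path_image ?g \<subseteq> S - {0}"
    proof -
      have "path_image ?g = cbox (Complex a (- T)) (Complex b T) - box (Complex a (- T)) (Complex b T)"
        using ab T by (intro path_image_rectpath_cbox_minus_box) auto
      also have "\<dots> \<subseteq> S - {0}"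
        using S(4) ab T by (auto simp: in_cbox_complex_iff in_box_complex_iff)
      finally show ?thesis .
    qed
    have "0 \<in> S" using S(4) ab by auto
    then have "((\<lambda>w. F w / (w - 0)) has_contour_integral (2 * pi * \<i> * winding_number ?g 0 * F 0)) ?g"
      using S sub by (intro Cauchy_integral_formula_convex_simple[of S]) (auto simp: interior_open)
    moreover have "winding_number ?g 0 = 1"
      using ab T by (intro winding_number_rectpath) (auto simp: in_box_complex_iff)
    ultimately show "contour_integral ?g (\<lambda>s. F s / s) = 2 * of_real pi * \<i> * F 0"
      by (auto dest!: contour_integral_unique)
  qed auto
  then have "\<i> * (LINT t|lborel. F (Complex b t) / Complex b t)
      = \<i> * ((LINT t|lborel. F (Complex a t) / Complex a t) + 2 * of_real pi * F 0)"
    by (simp add: algebra_simps)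
  then show ?thesis by (simp only: mult_left_cancel[OF complex_i_not_zero])
qed

section \<open>Mellin-type integrals in a logarithmic variable\<close>

lemma norm_exp_vertical:
  "norm (exp (- (Complex c t) * w)) = exp (- c * Re w + t * Im w)"
  by simp

text \<open>With w = log z the exponential is z^(-s), and the argument Im w of z uses up |Im w| of
  the decay rate b.\<close>

lemma exp_decay_mult_exp:
  fixes p :: "real \<Rightarrow> complex"
  assumes "\<And>t. norm (p t) \<le> C * exp (- b * \<bar>t\<bar>)"
  shows "norm (p t * exp (- (Complex c t) * w)) \<le> C * exp (- c * Re w) * exp (- (b - \<bar>Im w\<bar>) * \<bar>t\<bar>)"
proof -
  have C0: "C \<ge> 0" using assms[of 0] by (auto intro: order_trans[OF norm_ge_zero])
  have "t * Im w \<le> \<bar>Im w\<bar> * \<bar>t\<bar>" using abs_ge_self[of "t * Im w"] by (simp add: abs_mult mult.commute)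
  then have "norm (p t * exp (- (Complex c t) * w)) \<le> (C * exp (- b * \<bar>t\<bar>)) * exp (- c * Re w + \<bar>Im w\<bar> * \<bar>t\<bar>)"
    unfolding norm_mult norm_exp_vertical
    using C0 by (intro mult_mono assms) auto
  also have "\<dots> = C * exp (- c * Re w) * (exp (- b * \<bar>t\<bar>) * exp (\<bar>Im w\<bar> * \<bar>t\<bar>))"
    by (simp only: exp_add mult_ac)
  also have "exp (- b * \<bar>t\<bar>) * exp (\<bar>Im w\<bar> * \<bar>t\<bar>) = exp (- (b - \<bar>Im w\<bar>) * \<bar>t\<bar>)"
    by (simp flip: exp_add add: algebra_simps)
  finally show ?thesis .
qed

lemma integrable_exp_transform:
  fixes p :: "real \<Rightarrow> complex"
  assumes "continuous_on UNIV p" "\<And>t. norm (p t) \<le> C * exp (- b * \<bar>t\<bar>)" "\<bar>Im w\<bar> < b"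
  shows "integrable lborel (\<lambda>t. p t * exp (- (Complex c t) * w))"
  using assms(3)
  by (intro integrable_exp_decay[OF _ _ exp_decay_mult_exp[OF assms(2)]] continuous_intros assms(1)) auto

text \<open>Difference quotients are dominated through the mean value inequality on a small disc
  around w, so that dominated convergence along sequences differentiates under the integral.\<close>

lemma has_field_derivative_exp_transform:
  fixes p :: "real \<Rightarrow> complex"
  assumes cont: "continuous_on UNIV p" and bnd: "\<And>t. norm (p t) \<le> C * exp (- b * \<bar>t\<bar>)"
    and w: "\<bar>Im w\<bar> < b"
  shows "((\<lambda>w. LINT t|lborel. p t * exp (- (Complex c t) * w)) has_field_derivative
           (LINT t|lborel. - (Complex c t) * (p t * exp (- (Complex c t) * w)))) (at w)"
proof -
  \<comment> \<open>The margin b - |Im w| is split in three: one part is the radius of the disc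
    around w, one absorbs the factor \<open>Complex c t\<close> of the derivative, and one is left
    as the decay of the majorant \<open>W\<close>.\<close>
  define \<eta> where "\<eta> = (b - \<bar>Im w\<bar>) / 3"
  have \<eta>: "\<eta> > 0" "\<bar>Im w\<bar> + \<eta> < b" using w by (auto simp: \<eta>_def field_simps)
  have C0: "C \<ge> 0" using bnd[of 0] by (auto intro: order_trans[OF norm_ge_zero])
  define E where "E = exp (\<bar>c\<bar> * (norm w + \<eta>))"
  let ?q = "\<lambda>t w. exp (- (Complex c t) * w)"
  have q: "norm (?q t u) \<le> E * exp ((\<bar>Im w\<bar> + \<eta>) * \<bar>t\<bar>)" if u: "u \<in> cball w \<eta>" for t u
  proof -
    have du: "norm (u - w) \<le> \<eta>" using u by (simp add: dist_norm norm_minus_commute)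
    have "norm u \<le> norm w + \<eta>" using norm_triangle_sub[of u w] du by simp
    then have r: "\<bar>Re u\<bar> \<le> norm w + \<eta>" using abs_Re_le_cmod[of u] by simp
    have i: "\<bar>Im u\<bar> \<le> \<bar>Im w\<bar> + \<eta>" using abs_Im_le_cmod[of "u - w"] du by simp
    have "- c * Re u \<le> \<bar>c\<bar> * \<bar>Re u\<bar>" using abs_ge_self[of "- c * Re u"] by (simp add: abs_mult)
    also have "\<dots> \<le> \<bar>c\<bar> * (norm w + \<eta>)" using r by (intro mult_left_mono) auto
    finally have 1: "- c * Re u \<le> \<bar>c\<bar> * (norm w + \<eta>)" .
    have "t * Im u \<le> \<bar>Im u\<bar> * \<bar>t\<bar>" using abs_ge_self[of "t * Im u"] by (simp add: abs_mult mult.commute)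
    also have "\<dots> \<le> (\<bar>Im w\<bar> + \<eta>) * \<bar>t\<bar>" using i by (intro mult_right_mono) auto
    finally have 2: "t * Im u \<le> (\<bar>Im w\<bar> + \<eta>) * \<bar>t\<bar>" .
    show ?thesis unfolding norm_exp_vertical E_def exp_add[symmetric] using 1 2 by simp
  qed
  have nc: "norm (Complex c t) \<le> (\<bar>c\<bar> + 1 / \<eta>) * exp (\<eta> * \<bar>t\<bar>)" for t
  proof -
    have "\<bar>c\<bar> * 1 \<le> \<bar>c\<bar> * exp (\<eta> * \<bar>t\<bar>)" using \<eta> by (intro mult_left_mono) auto
    moreover have "\<bar>t\<bar> \<le> exp (\<eta> * \<bar>t\<bar>) / \<eta>" using \<eta> by (intro linear_le_exp) auto
    moreover have "norm (Complex c t) \<le> \<bar>c\<bar> + \<bar>t\<bar>" using cmod_le[of "Complex c t"] by simp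
    ultimately show ?thesis unfolding distrib_right by simp
  qed
  define W where "W t = C * E * (\<bar>c\<bar> + 1 / \<eta>) * exp (- \<eta> * \<bar>t\<bar>)" for t
  have dom: "norm (p t * ((?q t u - ?q t w) / (u - w))) \<le> W t" if u: "u \<in> cball w \<eta>" "u \<noteq> w" for t u
  proof -
    let ?B = "(\<bar>c\<bar> + 1 / \<eta>) * exp (\<eta> * \<bar>t\<bar>) * (E * exp ((\<bar>Im w\<bar> + \<eta>) * \<bar>t\<bar>))"
    have "norm (?q t u - ?q t w) \<le> ?B * norm (u - w)"
    proof (rule field_differentiable_bound[OF convex_cball[of w \<eta>]])
      fix z assume z: "z \<in> cball w \<eta>"
      show "(?q t has_field_derivative - (Complex c t) * ?q t z) (at z within cball w \<eta>)"
        by (auto intro!: derivative_eq_intros)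
      show "norm (- (Complex c t) * ?q t z) \<le> ?B"
        unfolding norm_mult norm_minus_cancel using q[OF z] nc \<eta>
        by (intro mult_mono) (auto simp: E_def)
    qed (use u \<eta> in auto)
    then have "norm ((?q t u - ?q t w) / (u - w)) \<le> ?B"
      using u(2) by (simp add: norm_divide pos_divide_le_eq)
    then have "norm (p t * ((?q t u - ?q t w) / (u - w))) \<le> (C * exp (- b * \<bar>t\<bar>)) * ?B"
      unfolding norm_mult using bnd C0 by (intro mult_mono) auto
    also have "\<dots> = C * E * (\<bar>c\<bar> + 1 / \<eta>) * (exp (- b * \<bar>t\<bar>) * exp (\<eta> * \<bar>t\<bar>) * exp ((\<bar>Im w\<bar> + \<eta>) * \<bar>t\<bar>))"
      by (simp add: mult_ac)
    also have "exp (- b * \<bar>t\<bar>) * exp (\<eta> * \<bar>t\<bar>) * exp ((\<bar>Im w\<bar> + \<eta>) * \<bar>t\<bar>) = exp (- \<eta> * \<bar>t\<bar>)"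
      unfolding exp_add[symmetric] by (rule arg_cong[of _ _ exp]) (simp add: \<eta>_def field_simps)
    finally show ?thesis by (simp add: W_def)
  qed
  have Wint: "integrable lborel W"
    unfolding W_def using integrable_exp_neg_abs[OF \<eta>(1)] by simp
  let ?G = "\<lambda>w. LINT t|lborel. p t * ?q t w"
  have "((\<lambda>u. (?G u - ?G w) / (u - w)) \<longlongrightarrow>
      (LINT t|lborel. - (Complex c t) * (p t * ?q t w))) (at w)"
    unfolding tendsto_at_iff_sequentially
  proof (intro allI impI)
    fix X :: "nat \<Rightarrow> complex" assume X: "\<forall>i. X i \<in> UNIV - {w}" "X \<longlonglongrightarrow> w"
    have "eventually (\<lambda>n. dist (X n) w < \<eta>) sequentially" using X(2) \<eta>(1) by (rule tendstoD)
    \<comment> \<open>Dropping N terms keeps all points in the disc where \<open>W\<close>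
      dominates; \<open>LIMSEQ_offset\<close> puts them back at the end.\<close>
    then obtain N where N: "\<And>n. n \<ge> N \<Longrightarrow> dist (X n) w < \<eta>"
      unfolding eventually_sequentially by blast
    have XN: "X (n + N) \<in> cball w \<eta>" "X (n + N) \<noteq> w" for n
      using N[of "n + N"] X(1) by (auto simp: dist_commute)
    have lim: "(\<lambda>n. LINT t|lborel. p t * ((?q t (X (n + N)) - ?q t w) / (X (n + N) - w)))
        \<longlonglongrightarrow> (LINT t|lborel. - (Complex c t) * (p t * ?q t w))"
    proof (rule integral_dominated_convergence[OF _ _ Wint])
      show "(\<lambda>t. - Complex c t * (p t * ?q t w)) \<in> borel_measurable lborel"
        by (simp, intro borel_measurable_continuous_onI continuous_intros cont)
      show "(\<lambda>t. p t * ((?q t (X (n + N)) - ?q t w) / (X (n + N) - w))) \<in> borel_measurable lborel" for n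
        using XN(2)[of n] by (simp, intro borel_measurable_continuous_onI continuous_intros cont) auto
      show "AE t in lborel. norm (p t * ((?q t (X (n + N)) - ?q t w) / (X (n + N) - w))) \<le> W t" for n
        using dom[OF XN] by (intro AE_I2)
      show "AE t in lborel. (\<lambda>n. p t * ((?q t (X (n + N)) - ?q t w) / (X (n + N) - w)))
          \<longlonglongrightarrow> - Complex c t * (p t * ?q t w)"
      proof (rule AE_I2)
        fix t
        have "(?q t has_field_derivative - (Complex c t) * ?q t w) (at w)"
          by (auto intro!: derivative_eq_intros)
        then have "((\<lambda>u. (?q t u - ?q t w) / (u - w)) \<longlongrightarrow> - (Complex c t) * ?q t w) (at w)"
          by (simp only: has_field_derivative_iff)
        then have "((\<lambda>u. (?q t u - ?q t w) / (u - w)) \<circ> (\<lambda>n. X (n + N))) \<longlonglongrightarrow> - (Complex c t) * ?q t w"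
          by (rule tendsto_at_iff_sequentially[THEN iffD1, rule_format])
            (use X LIMSEQ_ignore_initial_segment[OF X(2), of N] in simp_all)
        then have "(\<lambda>n. p t * ((?q t (X (n + N)) - ?q t w) / (X (n + N) - w)))
          \<longlonglongrightarrow> p t * (- (Complex c t) * ?q t w)"
          unfolding o_def by (intro tendsto_mult_left)
        then show "(\<lambda>n. p t * ((?q t (X (n + N)) - ?q t w) / (X (n + N) - w)))
          \<longlonglongrightarrow> - Complex c t * (p t * ?q t w)" by (simp add: mult_ac)
      qed
    qed
    have "(LINT t|lborel. p t * ((?q t (X (n + N)) - ?q t w) / (X (n + N) - w)))
        = (?G (X (n + N)) - ?G w) / (X (n + N) - w)" for n
    proof -
      have "\<bar>Im (X (n + N))\<bar> < b"
        using abs_Im_le_cmod[of "X (n + N) - w"] XN(1)[of n] \<eta>(2) by (simp add: dist_norm norm_minus_commute)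
      then have i: "integrable lborel (\<lambda>t. p t * ?q t (X (n + N)))" "integrable lborel (\<lambda>t. p t * ?q t w)"
        using integrable_exp_transform[OF cont bnd] w by blast+
      have "(LINT t|lborel. p t * ((?q t (X (n + N)) - ?q t w) / (X (n + N) - w)))
          = (LINT t|lborel. (p t * ?q t (X (n + N)) - p t * ?q t w) / (X (n + N) - w))"
        by (simp add: right_diff_distrib)
      then show ?thesis using i by (simp only: integral_divide_zero Bochner_Integration.integral_diff)
    qed
    then have "(\<lambda>n. (?G (X (n + N)) - ?G w) / (X (n + N) - w))
        \<longlonglongrightarrow> (LINT t|lborel. - (Complex c t) * (p t * ?q t w))"
      using lim by (simp only:)
    then show "((\<lambda>u. (?G u - ?G w) / (u - w)) \<circ> X) \<longlonglongrightarrow> (LINT t|lborel. - (Complex c t) * (p t * ?q t w))"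
      unfolding o_def by (rule LIMSEQ_offset)
  qed
  then show ?thesis by (simp only: has_field_derivative_iff)
qed

section \<open>The Cahen-Mellin integral\<close>

lemma continuous_on_Complex_line:
  assumes "F holomorphic_on S" "\<And>t. Complex c t \<in> S"
  shows "continuous_on UNIV (\<lambda>t. F (Complex c t))"
  using assms(2)
  by (intro continuous_on_compose2[OF holomorphic_on_imp_continuous_on[OF assms(1)]] continuous_intros) auto

text \<open>Any c off the poles of Gamma is allowed, negative ones included, because the line Re s =
  -1/2 is used to isolate the residue at 0.\<close>

lemma Gamma_line:
  assumes "0 \<le> b" "b < pi / 2" "c \<notin> \<int>\<^sub>\<le>\<^sub>0"
  shows "continuous_on UNIV (\<lambda>t. Gamma (Complex c t))"
    and "\<exists>C. \<forall>t. norm (Gamma (Complex c t)) \<le> C * exp (- b * \<bar>t\<bar>)"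
proof -
  have "Complex c t \<notin> \<int>\<^sub>\<le>\<^sub>0" for t
  proof
    assume "Complex c t \<in> \<int>\<^sub>\<le>\<^sub>0"
    then obtain n where "n \<le> 0" "Complex c t = of_int n" by (auto elim!: nonpos_Ints_cases)
    then have "c = of_int n" "n \<le> 0" by (simp_all add: complex_eq_iff)
    then show False using assms(3) nonpos_Ints_of_int by blast
  qed
  then show cont: "continuous_on UNIV (\<lambda>t. Gamma (Complex c t))"
    by (intro continuous_on_Complex_line[of Gamma "- \<int>\<^sub>\<le>\<^sub>0"] holomorphic_intros) auto
  obtain C where C: "\<And>s. \<bar>Re s\<bar> \<le> \<bar>c\<bar> \<Longrightarrow> \<bar>Im s\<bar> \<ge> 1 \<Longrightarrow> norm (Gamma s) \<le> C * exp (- b * \<bar>Im s\<bar>)"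
    using Gamma_decay_strip[OF assms(1,2)] by blast
  have "norm (Gamma (Complex c t)) \<le> C * exp (- b * \<bar>t\<bar>)" if "\<bar>t\<bar> \<ge> 1" for t
    using C[of "Complex c t"] that by simp
  then show "\<exists>C. \<forall>t. norm (Gamma (Complex c t)) \<le> C * exp (- b * \<bar>t\<bar>)"
    using exp_decay_extend[OF cont _ assms(1)] by metis
qed

text \<open>Inverse Mellin transform of \<open>exp (- z)\<close> at \<open>z = exp w\<close>.  By contour shift and
  \<open>s \<Gamma>(s) = \<Gamma>(s + 1)\<close> the transform satisfies \<open>J' = - exp w J\<close>; the constant is the
  residue of \<open>\<Gamma>\<close> at \<open>0\<close>, seen in the limit \<open>w \<rightarrow> -\<infinity>\<close>.\<close>
definition Gamma_transform :: "real \<Rightarrow> complex \<Rightarrow> complex" where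
  "Gamma_transform c w = (LINT t|lborel. Gamma (Complex c t) * exp (- (Complex c t) * w))"

lemma Gamma_transform_bound:
  assumes w: "\<bar>Im w\<bar> < pi / 2"
  obtains C \<delta> where "\<delta> > 0" "\<And>s. \<bar>Re s\<bar> \<le> K \<Longrightarrow> \<bar>Im s\<bar> \<ge> 1 \<Longrightarrow>
    norm (Gamma s * exp (- s * w)) \<le> C * exp (- \<delta> * \<bar>Im s\<bar>)"
proof -
  \<comment> \<open>Half the gap: the rate b = |Im w| + \<delta> is still below pi/2, hence
    available for Gamma, and \<delta> survives multiplication by exp(-s w).\<close>
  define \<delta> where "\<delta> = (pi / 2 - \<bar>Im w\<bar>) / 2"
  have \<delta>: "\<delta> > 0" using w by (auto simp: \<delta>_def)
  define b where "b = \<bar>Im w\<bar> + \<delta>"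
  have b: "0 \<le> b" "b < pi / 2" using w \<delta> by (auto simp: b_def \<delta>_def field_simps)
  obtain C where C: "\<And>s. \<bar>Re s\<bar> \<le> K \<Longrightarrow> \<bar>Im s\<bar> \<ge> 1 \<Longrightarrow> norm (Gamma s) \<le> C * exp (- b * \<bar>Im s\<bar>)"
    using Gamma_decay_strip[OF b] by blast
  show ?thesis
  proof (rule that[OF \<delta>])
    fix s assume s: "\<bar>Re s\<bar> \<le> K" "\<bar>Im s\<bar> \<ge> 1"
    have "Re (- s * w) \<le> K * \<bar>Re w\<bar> + \<bar>Im w\<bar> * \<bar>Im s\<bar>"
    proof -
      have "- (Re s * Re w) \<le> \<bar>Re s\<bar> * \<bar>Re w\<bar>" using abs_ge_self[of "- (Re s * Re w)"] by (simp add: abs_mult)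
      also have "\<dots> \<le> K * \<bar>Re w\<bar>" using s by (intro mult_right_mono) auto
      finally have "- (Re s * Re w) \<le> K * \<bar>Re w\<bar>" .
      moreover have "Im s * Im w \<le> \<bar>Im w\<bar> * \<bar>Im s\<bar>"
        using abs_ge_self[of "Im s * Im w"] by (simp add: abs_mult mult.commute)
      ultimately show ?thesis by simp
    qed
    then have "norm (exp (- s * w)) \<le> exp (K * \<bar>Re w\<bar> + \<bar>Im w\<bar> * \<bar>Im s\<bar>)" by simp
    then have "norm (Gamma s * exp (- s * w)) \<le> (C * exp (- b * \<bar>Im s\<bar>)) * exp (K * \<bar>Re w\<bar> + \<bar>Im w\<bar> * \<bar>Im s\<bar>)"
      unfolding norm_mult using C[OF s] by (intro mult_mono) (auto intro: order_trans[OF norm_ge_zero])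
    also have "\<dots> = C * exp (K * \<bar>Re w\<bar>) * (exp (- b * \<bar>Im s\<bar>) * exp (\<bar>Im w\<bar> * \<bar>Im s\<bar>))"
      by (simp only: exp_add mult_ac)
    also have "exp (- b * \<bar>Im s\<bar>) * exp (\<bar>Im w\<bar> * \<bar>Im s\<bar>) = exp (- \<delta> * \<bar>Im s\<bar>)"
      unfolding exp_add[symmetric] by (rule arg_cong[of _ _ exp]) (simp add: b_def algebra_simps)
    finally show "norm (Gamma s * exp (- s * w)) \<le> C * exp (K * \<bar>Re w\<bar>) * exp (- \<delta> * \<bar>Im s\<bar>)" .
  qed
qed

lemma Gamma_transform_shift:
  assumes w: "\<bar>Im w\<bar> < pi / 2" and ab: "0 < a" "a < b"
  shows "Gamma_transform b w = Gamma_transform a w"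
proof -
  obtain C \<delta> where C: "\<delta> > 0" "\<And>s. \<bar>Re s\<bar> \<le> b \<Longrightarrow> \<bar>Im s\<bar> \<ge> 1 \<Longrightarrow>
    norm (Gamma s * exp (- s * w)) \<le> C * exp (- \<delta> * \<bar>Im s\<bar>)"
    using Gamma_transform_bound[OF w, of b] by blast
  show ?thesis unfolding Gamma_transform_def
  proof (rule vertical_line_shift_holomorphic[OF ab(2) C(1), where S = "{s. Re s > 0}" and C = C
        and F = "\<lambda>s. Gamma s * exp (- s * w)"])
    show "(\<lambda>s. Gamma s * exp (- s * w)) holomorphic_on {s. Re s > 0}"
      by (intro holomorphic_intros) (auto elim!: nonpos_Ints_cases)
    show "convex {s. Re s > 0}" by (rule convex_halfspace_Re_gt)
  qed (use ab C(2) in auto)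
qed

lemma Gamma_transform_deriv:
  assumes w: "\<bar>Im w\<bar> < pi / 2" and c: "c > 0"
  shows "(Gamma_transform c has_field_derivative - exp w * Gamma_transform c w) (at w)"
proof -
  define b where "b = (\<bar>Im w\<bar> + pi / 2) / 2"
  have b: "0 \<le> b" "b < pi / 2" "\<bar>Im w\<bar> < b" using w by (auto simp: b_def field_simps)
  have cn: "c \<notin> \<int>\<^sub>\<le>\<^sub>0" using c by (auto elim!: nonpos_Ints_cases)
  obtain C where C: "\<And>t. norm (Gamma (Complex c t)) \<le> C * exp (- b * \<bar>t\<bar>)"
    using Gamma_line(2)[OF b(1,2) cn] by blast
  have "(Gamma_transform c has_field_derivative
      (LINT t|lborel. - (Complex c t) * (Gamma (Complex c t) * exp (- (Complex c t) * w)))) (at w)"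
    unfolding Gamma_transform_def[abs_def]
    by (rule has_field_derivative_exp_transform[OF Gamma_line(1)[OF b(1,2) cn] C b(3)])
  also have "(LINT t|lborel. - (Complex c t) * (Gamma (Complex c t) * exp (- (Complex c t) * w)))
      = (LINT t|lborel. - exp w * (Gamma (Complex (c + 1) t) * exp (- (Complex (c + 1) t) * w)))"
  proof (intro Bochner_Integration.integral_cong refl)
    fix t
    have e: "Complex (c + 1) t = Complex c t + 1" by (simp add: complex_eq_iff)
    have "Complex c t \<notin> \<int>\<^sub>\<le>\<^sub>0" using c by (auto elim!: nonpos_Ints_cases simp: complex_eq_iff)
    then have "Gamma (Complex (c + 1) t) = Complex c t * Gamma (Complex c t)"
      unfolding e by (rule Gamma_plus1)
    moreover have "exp (- (Complex (c + 1) t) * w) = exp (- (Complex c t) * w) * exp (- w)"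
      unfolding e by (simp flip: exp_add add: algebra_simps)
    ultimately show "- (Complex c t) * (Gamma (Complex c t) * exp (- (Complex c t) * w))
        = - exp w * (Gamma (Complex (c + 1) t) * exp (- (Complex (c + 1) t) * w))"
      by (simp add: exp_minus)
  qed
  also have "\<dots> = - exp w * Gamma_transform (c + 1) w"
    unfolding Gamma_transform_def by (rule integral_mult_right_zero)
  also have "Gamma_transform (c + 1) w = Gamma_transform c w"
    using w c by (intro Gamma_transform_shift) auto
  finally show ?thesis .
qed

text \<open>Between the lines -1/2 and 1 the only pole of Gamma is 0. Writing Gamma(s) = Gamma(s +
  1)/s exhibits it, with residue Gamma(1) = 1.\<close>

lemma Gamma_transform_left:
  "Gamma_transform 1 w = (LINT t|lborel. Gamma (Complex (- 1 / 2) t) * exp (- (Complex (- 1 / 2) t) * w)) + 2 * of_real pi"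
  if w: "\<bar>Im w\<bar> < pi / 2"
proof -
  let ?F = "\<lambda>s. Gamma (s + 1) * exp (- s * w)"
  have F: "?F s / s = Gamma s * exp (- s * w)" if "Re s = 1 \<or> Re s = - 1 / 2 \<or> \<bar>Im s\<bar> \<ge> 1" for s
  proof -
    have "s \<notin> \<int>\<^sub>\<le>\<^sub>0"
    proof
      assume "s \<in> \<int>\<^sub>\<le>\<^sub>0"
      then obtain n where n: "s = - of_nat n" by (auto elim!: nonpos_Ints_cases')
      with that have "real n = 1 / 2" by auto
      then have "2 * real n = 1" by simp
      then have "real (2 * n) = real 1" by simp
      then have "2 * n = 1" by (simp only: of_nat_eq_iff)
      then show False by presburger
    qed
    then show ?thesis by (subst Gamma_plus1) auto
  qed
  obtain C \<delta> where C: "\<delta> > 0" "\<And>s. \<bar>Re s\<bar> \<le> 1 \<Longrightarrow> \<bar>Im s\<bar> \<ge> 1 \<Longrightarrow>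
    norm (Gamma s * exp (- s * w)) \<le> C * exp (- \<delta> * \<bar>Im s\<bar>)"
    using Gamma_transform_bound[OF w, of 1] by blast
  have "(LINT t|lborel. ?F (Complex 1 t) / Complex 1 t)
       = (LINT t|lborel. ?F (Complex (- 1 / 2) t) / Complex (- 1 / 2) t) + 2 * of_real pi * ?F 0"
  proof (rule vertical_line_shift_residue[where F = ?F and S = "{s. Re s > - 1}", OF _ _ C(1)])
    show "?F holomorphic_on {s. Re s > - 1}"
      by (intro holomorphic_intros) (auto elim!: nonpos_Ints_cases simp: complex_eq_iff)
    show "convex {s. Re s > - 1}" by (rule convex_halfspace_Re_gt)
    show "open {s. Re s > - 1}" by (rule open_halfspace_Re_gt)
    fix s assume "- 1 / 2 \<le> Re s" "Re s \<le> 1" "1 \<le> \<bar>Im s\<bar>"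
    then show "norm (?F s / s) \<le> C * exp (- \<delta> * \<bar>Im s\<bar>)" using C(2)[of s] F[of s] by auto
  qed auto
  moreover have "(LINT t|lborel. ?F (Complex 1 t) / Complex 1 t) = Gamma_transform 1 w"
    unfolding Gamma_transform_def by (intro Bochner_Integration.integral_cong refl F) simp
  moreover have "(LINT t|lborel. ?F (Complex (- 1 / 2) t) / Complex (- 1 / 2) t)
      = (LINT t|lborel. Gamma (Complex (- 1 / 2) t) * exp (- (Complex (- 1 / 2) t) * w))"
    by (intro Bochner_Integration.integral_cong refl F) simp
  moreover have "?F 0 = 1" by simp
  ultimately show ?thesis by (simp only: mult_1_right)
qed

text \<open>On the line Re s = -1/2 the factor exp(-s w) at w = -n has norm exp(-n/2), so only the
  residue term survives.\<close>

lemma Gamma_transform_one_tendsto: "(\<lambda>n. Gamma_transform 1 (- of_nat n)) \<longlonglongrightarrow> 2 * of_real pi"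
proof -
  have nn: "(- 1 / 2 :: real) \<notin> \<int>\<^sub>\<le>\<^sub>0"
  proof
    assume "(- 1 / 2 :: real) \<in> \<int>\<^sub>\<le>\<^sub>0"
    then obtain n where n: "(- 1 / 2 :: real) = - of_nat n" by (auto elim!: nonpos_Ints_cases')
    then have "real (2 * n) = real 1" by simp
    then have "2 * n = 1" by (simp only: of_nat_eq_iff)
    then show False by presburger
  qed
  have one: "0 \<le> (1 :: real)" "(1 :: real) < pi / 2" using pi_gt3 by auto
  obtain C where C: "\<And>t. norm (Gamma (Complex (- 1 / 2) t)) \<le> C * exp (- 1 * \<bar>t\<bar>)"
    using Gamma_line(2)[OF one nn] by blast
  let ?I = "\<lambda>w. LINT t|lborel. Gamma (Complex (- 1 / 2) t) * exp (- (Complex (- 1 / 2) t) * w)"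
  have "norm (?I (- of_nat n)) \<le> exp (- (1 / 2) * real n) * (LINT t|lborel. C * exp (- 1 * \<bar>t\<bar>))" for n
  proof -
    have "norm (?I (- of_nat n)) \<le> (LINT t|lborel. norm (Gamma (Complex (- 1 / 2) t) * exp (- (Complex (- 1 / 2) t) * - of_nat n)))"
      by (rule integral_norm_bound)
    also have "\<dots> \<le> (LINT t|lborel. exp (- (1 / 2) * real n) * (C * exp (- 1 * \<bar>t\<bar>)))"
    proof (rule integral_mono)
      show "integrable lborel (\<lambda>t. norm (Gamma (Complex (- 1 / 2) t) * exp (- (Complex (- 1 / 2) t) * - of_nat n)))"
        by (intro integrable_norm integrable_exp_transform[OF Gamma_line(1)[OF one nn] C]) auto
      show "integrable lborel (\<lambda>t. exp (- (1 / 2) * real n) * (C * exp (- 1 * \<bar>t\<bar>)))"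
        using integrable_exp_neg_abs[of 1] by simp
      fix t
      show "norm (Gamma (Complex (- 1 / 2) t) * exp (- (Complex (- 1 / 2) t) * - of_nat n))
          \<le> exp (- (1 / 2) * real n) * (C * exp (- 1 * \<bar>t\<bar>))"
        unfolding norm_mult norm_exp_vertical using mult_right_mono[OF C[of t], of "exp (- (1 / 2) * real n)"]
        by (simp add: mult.commute)
    qed
    also have "\<dots> = exp (- (1 / 2) * real n) * (LINT t|lborel. C * exp (- 1 * \<bar>t\<bar>))"
      by (rule integral_mult_right_zero)
    finally show ?thesis .
  qed
  then have ev: "eventually (\<lambda>n. norm (?I (- of_nat n)) \<le> exp (- (1 / 2) * real n) * (LINT t|lborel. C * exp (- 1 * \<bar>t\<bar>))) sequentially"
    by (intro always_eventually allI)
  have "(\<lambda>n. exp (- (1 / 2) * real n)) \<longlonglongrightarrow> 0" by real_asymp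
  then have "(\<lambda>n. exp (- (1 / 2) * real n) * (LINT t|lborel. C * exp (- 1 * \<bar>t\<bar>))) \<longlonglongrightarrow> 0"
    by (rule tendsto_mult_left_zero)
  with ev have "(\<lambda>n. ?I (- of_nat n)) \<longlonglongrightarrow> 0" by (rule Lim_null_comparison)
  then have "(\<lambda>n. ?I (- of_nat n) + 2 * of_real pi) \<longlonglongrightarrow> 0 + 2 * of_real pi" by (intro tendsto_intros)
  then show ?thesis by (subst Gamma_transform_left) auto
qed

lemma Cahen_Mellin:
  assumes w: "\<bar>Im w\<bar> < pi / 2" and c: "c \<ge> 1"
  shows "Gamma_transform c w = 2 * of_real pi * exp (- exp w)"
proof -
  let ?S = "{w. - (pi / 2) < Im w} \<inter> {w. Im w < pi / 2}"
  have S: "convex ?S"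
    by (intro convex_Int convex_halfspace_Im_gt convex_halfspace_Im_lt)
  \<comment> \<open>The expected solution exp(-exp w) is divided out, and the quotient is constant
    because the strip is convex.\<close>
  have "((\<lambda>w. Gamma_transform 1 w * exp (exp w)) has_field_derivative 0) (at w within ?S)" if "w \<in> ?S" for w
  proof -
    have "\<bar>Im w\<bar> < pi / 2" using that by auto
    then have "(Gamma_transform 1 has_field_derivative - exp w * Gamma_transform 1 w) (at w)"
      by (intro Gamma_transform_deriv) auto
    then have "((\<lambda>w. Gamma_transform 1 w * exp (exp w)) has_field_derivative
        - exp w * Gamma_transform 1 w * exp (exp w) + exp (exp w) * exp w * Gamma_transform 1 w) (at w)"
      by (auto intro!: derivative_eq_intros)
    then show ?thesis by (simp add: mult_ac has_field_derivative_at_within)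
  qed
  then have "\<exists>K. \<forall>w\<in>?S. Gamma_transform 1 w * exp (exp w) = K"
    by (intro has_field_derivative_zero_constant[OF S])
  then obtain K where K': "\<forall>w\<in>?S. Gamma_transform 1 w * exp (exp w) = K" ..
  then have K: "Gamma_transform 1 w * exp (exp w) = K" if "\<bar>Im w\<bar> < pi / 2" for w
    using that by auto
  have "(\<lambda>n. exp (exp (- of_nat n :: complex))) \<longlonglongrightarrow> exp 0"
  proof (intro tendsto_intros)
    have "(\<lambda>n. exp (- real n)) \<longlonglongrightarrow> 0" by real_asymp
    then have "(\<lambda>n. complex_of_real (exp (- real n))) \<longlonglongrightarrow> of_real 0" by (rule tendsto_of_real)
    then show "(\<lambda>n. exp (- of_nat n :: complex)) \<longlonglongrightarrow> 0" by (simp add: exp_of_real[symmetric])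
  qed
  from tendsto_mult[OF Gamma_transform_one_tendsto this]
  have "(\<lambda>n. K) \<longlonglongrightarrow> 2 * of_real pi" by (simp add: K)
  then have "K = 2 * of_real pi" by (simp add: LIMSEQ_const_iff)
  then have "Gamma_transform 1 w * exp (exp w) = 2 * of_real pi" using K[OF w] by simp
  moreover have "Gamma_transform c w = Gamma_transform 1 w"
    using Gamma_transform_shift[OF w, of 1 c] c by (cases "c = 1") auto
  ultimately show ?thesis by (simp add: exp_minus field_simps)
qed

text \<open>The Cahen-Mellin formula is applied to each term at w + log(2 pi (m + 1)). Sum and
  integral may be interchanged because the norm of each term is a summable constant times one fixed
  integrable function of t.\<close>

lemma exp_series_eq_transform:
  fixes a :: "nat \<Rightarrow> complex"
  assumes c: "c \<ge> 1" and summ: "summable (\<lambda>m. norm (a m) * real (m + 1) powr (- c))"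
    and w: "\<bar>Im w\<bar> < pi / 2"
  shows "(\<lambda>m. a m * exp (- 2 * of_real pi * of_nat (m + 1) * exp w)) sums
     ((LINT t|lborel. Gamma (Complex c t) * of_real (2 * pi) powr (- (Complex c t))
         * (\<Sum>m. a m / of_nat (m + 1) powr (Complex c t)) * exp (- (Complex c t) * w)) / (2 * of_real pi))"
proof -
  define b where "b = (\<bar>Im w\<bar> + pi / 2) / 2"
  have b: "0 \<le> b" "b < pi / 2" "\<bar>Im w\<bar> < b" using w by (auto simp: b_def field_simps)
  have cn: "c \<notin> \<int>\<^sub>\<le>\<^sub>0" using c by (auto elim!: nonpos_Ints_cases)
  obtain C where C: "\<And>t. norm (Gamma (Complex c t)) \<le> C * exp (- b * \<bar>t\<bar>)"
    using Gamma_line(2)[OF b(1,2) cn] by blast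
  \<comment> \<open>A real shift: Im (w + l m) = Im w stays in the strip of validity for all
    m.\<close>
  define l where "l m = complex_of_real (ln (2 * pi * real (m + 1)))" for m
  have explm: "exp (l m) = 2 * of_real pi * of_nat (m + 1)" for m
    unfolding l_def exp_of_real by (subst exp_ln) (auto simp: add_pos_nonneg)
  have expl: "exp (- s * l m) = of_real (2 * pi) powr (- s) / of_nat (m + 1) powr s" for s m
  proof -
    have "l m = of_real (ln (2 * pi)) + of_real (ln (real (m + 1)))"
      unfolding l_def by (subst ln_mult) (auto simp del: of_nat_add of_nat_Suc)
    then have "exp (- s * l m) = exp (- s * of_real (ln (2 * pi))) * exp (- s * of_real (ln (real (m + 1))))"
      by (simp add: exp_add[symmetric] algebra_simps)
    also have "exp (- s * of_real (ln (2 * pi))) = of_real (2 * pi) powr (- s)"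
      unfolding powr_def using Ln_of_real[of "2 * pi"] by (simp del: of_real_mult)
    also have "exp (- s * of_real (ln (real (m + 1)))) = inverse (of_nat (m + 1) powr s)"
      unfolding powr_minus[symmetric] by (simp add: powr_def Ln_of_nat del: of_nat_Suc of_nat_add)
    finally show ?thesis by (simp add: divide_inverse)
  qed
  define h where "h m t = a m * (Gamma (Complex c t) * exp (- (Complex c t) * (w + l m)))" for m t
  define D where "D = (LINT t|lborel. norm (Gamma (Complex c t) * exp (- (Complex c t) * w)))"
  have hn: "h m t = a m * exp (- (Complex c t) * l m) * (Gamma (Complex c t) * exp (- (Complex c t) * w))" for m t
    by (simp add: h_def exp_add[symmetric] algebra_simps)
  have nl: "norm (exp (- (Complex c t) * l m)) = (2 * pi) powr (- c) * real (m + 1) powr (- c)" for m t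
  proof -
    have "norm (exp (- (Complex c t) * l m)) = exp (- c * ln (2 * pi * real (m + 1)))"
      by (simp add: l_def)
    also have "\<dots> = (2 * pi * real (m + 1)) powr (- c)" by (simp add: powr_def add_pos_nonneg)
    also have "\<dots> = (2 * pi) powr (- c) * real (m + 1) powr (- c)" by (rule powr_mult)
    finally show ?thesis .
  qed
  have iw: "integrable lborel (\<lambda>t. Gamma (Complex c t) * exp (- (Complex c t) * w))"
    by (rule integrable_exp_transform[OF Gamma_line(1)[OF b(1,2) cn] C b(3)])
  have ih: "integrable lborel (h m)" for m
    unfolding h_def[abs_def] using b(3)
    by (intro integrable_mult_right integrable_exp_transform[OF Gamma_line(1)[OF b(1,2) cn] C]) (auto simp: l_def)
  have nh: "norm (h m t) = (2 * pi) powr (- c) * (norm (a m) * real (m + 1) powr (- c)) * norm (Gamma (Complex c t) * exp (- (Complex c t) * w))" for m t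
    unfolding hn norm_mult[of "a m * _"] norm_mult[of "a m"] nl by (simp only: mult_ac)
  have s1: "AE t in lborel. summable (\<lambda>m. norm (h m t))"
    unfolding nh by (intro AE_I2 summable_mult2 summable_mult summ)
  have s2: "summable (\<lambda>m. LINT t|lborel. norm (h m t))"
    unfolding nh integral_mult_right_zero by (intro summable_mult2 summable_mult summ)
  have int: "(LINT t|lborel. h m t) = 2 * of_real pi * (a m * exp (- 2 * of_real pi * of_nat (m + 1) * exp w))" for m
  proof -
    have "(LINT t|lborel. h m t) = a m * Gamma_transform c (w + l m)"
      unfolding h_def Gamma_transform_def by (rule integral_mult_right_zero)
    also have "Gamma_transform c (w + l m) = 2 * of_real pi * exp (- exp (w + l m))"
      using w c by (intro Cahen_Mellin) (auto simp: l_def)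
    also have "exp (w + l m) = 2 * of_real pi * of_nat (m + 1) * exp w"
      unfolding exp_add explm by (simp only: mult_ac)
    finally show ?thesis by (simp add: mult_ac)
  qed
  have "(\<lambda>m. LINT t|lborel. h m t) sums (LINT t|lborel. (\<Sum>m. h m t))"
    by (rule sums_integral[OF ih s1 s2])
  then have "(\<lambda>m. 2 * of_real pi * (a m * exp (- 2 * of_real pi * of_nat (m + 1) * exp w)) / (2 * of_real pi))
      sums ((LINT t|lborel. (\<Sum>m. h m t)) / (2 * of_real pi))"
    unfolding int by (rule sums_divide)
  moreover have "(\<Sum>m. h m t) = Gamma (Complex c t) * of_real (2 * pi) powr (- (Complex c t))
         * (\<Sum>m. a m / of_nat (m + 1) powr (Complex c t)) * exp (- (Complex c t) * w)" for t
  proof -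
    let ?X = "Gamma (Complex c t) * of_real (2 * pi) powr (- (Complex c t)) * exp (- (Complex c t) * w)"
    have "norm (a m / of_nat (m + 1) powr (Complex c t)) = norm (a m) * real (m + 1) powr (- c)" for m
    proof -
      have "norm (of_nat (m + 1) powr (Complex c t)) = real (m + 1) powr c"
        using norm_powr_real_powr[of "of_nat (m + 1)" "Complex c t"] by simp
      then show ?thesis by (simp add: norm_mult norm_inverse powr_minus divide_inverse del: of_nat_add of_nat_Suc)
    qed
    then have "summable (\<lambda>m. norm (a m / of_nat (m + 1) powr (Complex c t)))" using summ by (simp only:)
    then have "summable (\<lambda>m. a m / of_nat (m + 1) powr (Complex c t))" by (rule summable_norm_cancel)
    then have "(\<Sum>m. ?X * (a m / of_nat (m + 1) powr (Complex c t)))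
        = ?X * (\<Sum>m. a m / of_nat (m + 1) powr (Complex c t))" by (rule suminf_mult)
    moreover have "h m t = ?X * (a m / of_nat (m + 1) powr (Complex c t))" for m
      unfolding hn expl by simp
    ultimately show ?thesis by (simp only: mult_ac)
  qed
  ultimately show ?thesis by simp
qed

section \<open>The completed L-functions\<close>

lemma norm_sin_le: "norm (sin z) \<le> exp \<bar>Im z\<bar>" for z :: complex
proof -
  have "sin z = (exp (\<i> * z) - exp (- (\<i> * z))) / (2 * \<i>)" by (simp add: sin_exp_eq)
  then have "norm (sin z) = norm (exp (\<i> * z) - exp (- (\<i> * z))) / 2"
    by (simp only: norm_divide norm_mult) simp
  also have "\<dots> \<le> (norm (exp (\<i> * z)) + norm (exp (- (\<i> * z)))) / 2"
    by (intro divide_right_mono norm_triangle_ineq4) auto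
  also have "\<dots> = (exp (- Im z) + exp (Im z)) / 2" by simp
  also have "\<dots> \<le> (exp \<bar>Im z\<bar> + exp \<bar>Im z\<bar>) / 2" by (intro divide_right_mono add_mono) auto
  finally show ?thesis by simp
qed

lemma not_nonpos_Int_if_Re_pos: "Re z > 0 \<Longrightarrow> z \<notin> \<int>\<^sub>\<le>\<^sub>0"
  by (auto elim!: nonpos_Ints_cases)

text \<open>The hypotheses form a locale because they are used twice: for \<open>A\<close>, and for
  the reflected coefficients that govern the lower half-plane.\<close>

locale functional_equation_pair =
  fixes A :: "int \<Rightarrow> complex" and \<alpha> :: real and \<Lambda> :: "nat \<Rightarrow> complex \<Rightarrow> complex"
  assumes \<alpha>: "\<alpha> \<ge> 0"
    and summ: "\<And>\<epsilon> s. \<epsilon> \<in> {0, 1} \<Longrightarrow> Re s > \<alpha> \<Longrightarrow>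
           summable (\<lambda>m. (A (int m + 1) + (-1) ^ \<epsilon> * A (- (int m + 1))) / of_nat (m + 1) powr s)"
    and entire: "\<And>\<epsilon>. \<epsilon> \<in> {0, 1} \<Longrightarrow> \<Lambda> \<epsilon> holomorphic_on UNIV"
    and order: "\<And>\<epsilon>. \<epsilon> \<in> {0, 1} \<Longrightarrow> finite_order (\<Lambda> \<epsilon>)"
    and completed: "\<And>\<epsilon> s. \<epsilon> \<in> {0, 1} \<Longrightarrow> Re s > \<alpha> \<Longrightarrow> \<Lambda> \<epsilon> s = gam (s + of_nat \<epsilon>) * Lser A \<epsilon> s"
    and feq: "\<And>\<epsilon> s. \<epsilon> \<in> {0, 1} \<Longrightarrow> \<Lambda> \<epsilon> (1 - s) = (-1) ^ \<epsilon> * \<Lambda> \<epsilon> s"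
begin

text \<open>The coefficients are \<open>O(m\<^bsup>\<alpha> + 1\<^esup>)\<close>, so both series converge absolutely on \<open>Re s = c\<close>.\<close>
definition c :: real where "c = \<alpha> + 3"

lemma c: "c > \<alpha>" "c \<ge> 1" "c > 1 / 2" using \<alpha> by (auto simp: c_def)

text \<open>The terms of both series at s = \<alpha> + 1 tend to 0 and so are bounded; half the sum
  and half the difference of the two combinations recover the coefficients themselves.\<close>

lemma coeff_bound:
  obtains K where "\<And>m. norm (A (int m + 1)) \<le> K * real (m + 1) powr (\<alpha> + 1)"
    "\<And>m. norm (A (- (int m + 1))) \<le> K * real (m + 1) powr (\<alpha> + 1)"
proof -
  have "\<exists>K. \<forall>m. norm (A (int m + 1) + (-1) ^ \<epsilon> * A (- (int m + 1))) \<le> K * real (m + 1) powr (\<alpha> + 1)"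
    if \<epsilon>: "\<epsilon> \<in> {0, 1}" for \<epsilon> :: nat
  proof -
    have "summable (\<lambda>m. (A (int m + 1) + (-1) ^ \<epsilon> * A (- (int m + 1))) / of_nat (m + 1) powr of_real (\<alpha> + 1))"
      using \<epsilon> by (intro summ) auto
    then have "(\<lambda>m. (A (int m + 1) + (-1) ^ \<epsilon> * A (- (int m + 1))) / of_nat (m + 1) powr of_real (\<alpha> + 1)) \<longlonglongrightarrow> 0"
      by (rule summable_LIMSEQ_zero)
    then have "Bseq (\<lambda>m. (A (int m + 1) + (-1) ^ \<epsilon> * A (- (int m + 1))) / of_nat (m + 1) powr of_real (\<alpha> + 1))"
      by (intro convergent_imp_Bseq convergentI)
    then obtain K where K: "\<And>m. norm ((A (int m + 1) + (-1) ^ \<epsilon> * A (- (int m + 1))) / of_nat (m + 1) powr of_real (\<alpha> + 1)) \<le> K"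
      unfolding Bseq_def by blast
    have "norm (A (int m + 1) + (-1) ^ \<epsilon> * A (- (int m + 1))) \<le> K * real (m + 1) powr (\<alpha> + 1)" for m
    proof -
      have "norm (of_nat (m + 1) powr complex_of_real (\<alpha> + 1)) = real (m + 1) powr (\<alpha> + 1)"
        using norm_powr_real_powr[of "of_nat (m + 1)" "of_real (\<alpha> + 1)"] by simp
      then show ?thesis using K[of m] unfolding norm_divide by (subst (asm) pos_divide_le_eq) simp_all
    qed
    then show ?thesis by blast
  qed
  from this[of 0] this[of 1] obtain K0 K1 where
    K0: "\<And>m. norm (A (int m + 1) + A (- (int m + 1))) \<le> K0 * real (m + 1) powr (\<alpha> + 1)" and
    K1: "\<And>m. norm (A (int m + 1) - A (- (int m + 1))) \<le> K1 * real (m + 1) powr (\<alpha> + 1)"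
    by auto
  show ?thesis
  proof (rule that)
    fix m
    let ?a = "A (int m + 1)" and ?b = "A (- (int m + 1))" and ?r = "real (m + 1) powr (\<alpha> + 1)"
    have "2 * norm ?a = norm ((?a + ?b) + (?a - ?b))" by (simp add: norm_mult)
    also have "\<dots> \<le> K0 * ?r + K1 * ?r" by (intro norm_triangle_le add_mono K0 K1)
    finally show "norm ?a \<le> (K0 + K1) / 2 * ?r" by (simp add: field_simps)
    have "2 * norm ?b = norm ((?a + ?b) - (?a - ?b))" by (simp add: norm_mult)
    also have "\<dots> \<le> K0 * ?r + K1 * ?r" by (intro order_trans[OF norm_triangle_ineq4] add_mono K0 K1)
    finally show "norm ?b \<le> (K0 + K1) / 2 * ?r" by (simp add: field_simps)
  qed
qed

lemma abs_summable_coeff: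
  "summable (\<lambda>m. norm (A (int m + 1)) * real (m + 1) powr (- c))"
  "summable (\<lambda>m. norm (A (- (int m + 1))) * real (m + 1) powr (- c))"
proof -
  obtain K where K: "\<And>m. norm (A (int m + 1)) \<le> K * real (m + 1) powr (\<alpha> + 1)"
    "\<And>m. norm (A (- (int m + 1))) \<le> K * real (m + 1) powr (\<alpha> + 1)"
    using coeff_bound by blast
  have "summable (\<lambda>m. real m powr (- 2))" by (subst summable_real_powr_iff) simp
  then have "summable (\<lambda>m. real (m + 1) powr (- 2))"
    unfolding summable_iff_shift[of "\<lambda>m. real m powr (- 2)" 1] .
  then have S: "summable (\<lambda>m. K * real (m + 1) powr (- 2))" by (rule summable_mult)
  \<comment> \<open>The choice c = \<alpha> + 3 makes the total exponent -2.\<close>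
  have e: "K * real (m + 1) powr (\<alpha> + 1) * real (m + 1) powr (- c) = K * real (m + 1) powr (- 2)" for m
    unfolding mult.assoc powr_add[symmetric] by (simp add: c_def)
  show "summable (\<lambda>m. norm (A (int m + 1)) * real (m + 1) powr (- c))"
  proof (rule summable_comparison_test'[OF S, of 0])
    fix m
    have "norm (A (int m + 1)) * real (m + 1) powr (- c) \<le> K * real (m + 1) powr (- 2)"
      unfolding e[symmetric] by (intro mult_right_mono K) simp
    then show "norm (norm (A (int m + 1)) * real (m + 1) powr (- c)) \<le> K * real (m + 1) powr (- 2)"
      by simp
  qed
  show "summable (\<lambda>m. norm (A (- (int m + 1))) * real (m + 1) powr (- c))"
  proof (rule summable_comparison_test'[OF S, of 0])
    fix m
    have "norm (A (- (int m + 1))) * real (m + 1) powr (- c) \<le> K * real (m + 1) powr (- 2)"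
      unfolding e[symmetric] by (intro mult_right_mono K) simp
    then show "norm (norm (A (- (int m + 1))) * real (m + 1) powr (- c)) \<le> K * real (m + 1) powr (- 2)"
      by simp
  qed
qed

lemma norm_term:
  "norm (x / of_nat (m + 1) powr s) = norm x * real (m + 1) powr (- Re s)"
proof -
  have "norm (of_nat (m + 1) powr s) = real (m + 1) powr Re s"
    using norm_powr_real_powr[of "of_nat (m + 1)" s] by simp
  then show ?thesis by (simp add: norm_mult norm_inverse powr_minus divide_inverse del: of_nat_add of_nat_Suc)
qed

lemma summable_terms:
  assumes "Re s = c"
  shows "summable (\<lambda>m. norm (A (int m + 1) / of_nat (m + 1) powr s))"
    "summable (\<lambda>m. norm (A (- (int m + 1)) / of_nat (m + 1) powr s))"
  unfolding norm_term assms by (rule abs_summable_coeff)+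

lemma Lser_bound:
  obtains B where "\<And>s. Re s = c \<Longrightarrow> norm (Lser A \<epsilon> s) \<le> B"
proof (rule that)
  fix s assume s: "Re s = c"
  let ?n = "\<lambda>m. norm (A (int m + 1)) * real (m + 1) powr (- c) + norm (A (- (int m + 1))) * real (m + 1) powr (- c)"
  have S: "summable ?n" by (intro summable_add abs_summable_coeff)
  have "norm (Lser A \<epsilon> s) \<le> suminf ?n" unfolding Lser_def
  proof (rule norm_suminf_le)
    show "norm ((A (int m + 1) + (-1) ^ \<epsilon> * A (- (int m + 1))) / of_nat (m + 1) powr s) \<le> ?n m" for m
      unfolding norm_term s distrib_right[symmetric]
      by (intro mult_right_mono norm_triangle_le) (auto simp: norm_mult norm_power)
  qed (rule S)
  then show "norm (Lser A \<epsilon> s) \<le> suminf ?n" .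
qed

text \<open>On the upper half-plane \<open>fA\<close> sees positive indices only, and A_m is half
  the sum of the even and odd combinations in the two L-series.\<close>

lemma Lser_half_sum:
  assumes "Re s = c"
  shows "(\<Sum>m. A (int m + 1) / of_nat (m + 1) powr s) = (Lser A 0 s + Lser A 1 s) / 2"
proof -
  have S: "summable (\<lambda>m. A (int m + 1) / of_nat (m + 1) powr s)"
    "summable (\<lambda>m. A (- (int m + 1)) / of_nat (m + 1) powr s)"
    using summable_terms[OF assms] by (blast intro: summable_norm_cancel)+
  have "Lser A 0 s = (\<Sum>m. A (int m + 1) / of_nat (m + 1) powr s) + (\<Sum>m. A (- (int m + 1)) / of_nat (m + 1) powr s)"
    unfolding Lser_def suminf_add[OF S] by (simp add: add_divide_distrib)
  moreover have "Lser A 1 s = (\<Sum>m. A (int m + 1) / of_nat (m + 1) powr s) - (\<Sum>m. A (- (int m + 1)) / of_nat (m + 1) powr s)"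
    unfolding Lser_def suminf_diff[OF S] by (simp add: diff_divide_distrib)
  ultimately show ?thesis by simp
qed

section \<open>Gamma factors: symmetrising the functional equation\<close>

definition trig :: "nat \<Rightarrow> complex \<Rightarrow> complex" where
  "trig \<epsilon> s = sin (of_real pi * ((s + of_nat \<epsilon>) / 2))"

text \<open>\<open>M\<close> continues \<open>(2\<pi>)\<^sup>-\<^sup>s \<Gamma>(s) L\<^sub>\<epsilon>(s)\<close>, and \<open>M = P trig\<close>.  Passing from \<open>M\<close> to \<open>P\<close>
  turns the functional equation into \<open>P(1 - s) = \<plusminus> P(s)\<close>.\<close>
definition M :: "nat \<Rightarrow> complex \<Rightarrow> complex" where
  "M \<epsilon> s = 4 * of_real pi ^ \<epsilon> * 2 powr (- s) * \<Lambda> \<epsilon> s * Gamma s * rGamma ((s + of_nat \<epsilon>) / 2) ^ 2"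

text \<open>The two Gamma arguments are exchanged by s -> 1 - s, so \<open>P\<close> inherits the
  sign of the functional equation of \<Lambda>. The constant in front is what duplication and
  reflection leave over when \<open>trig\<close> is split off from \<open>M\<close>.\<close>

definition P :: "nat \<Rightarrow> complex \<Rightarrow> complex" where
  "P \<epsilon> s = 2 * of_real pi ^ \<epsilon> / (of_real pi * of_real (sqrt pi)) * \<Lambda> \<epsilon> s *
     Gamma ((s + 1 - of_nat \<epsilon>) / 2) * Gamma (1 - (s + of_nat \<epsilon>) / 2)"

lemma nonint_half:
  fixes s :: complex
  assumes "s \<notin> \<int>" shows "(s + of_int n) / 2 \<notin> \<int>\<^sub>\<le>\<^sub>0"
proof
  assume "(s + of_int n) / 2 \<in> \<int>\<^sub>\<le>\<^sub>0"
  then obtain k where "(s + of_int n) / 2 = of_int k" by (auto elim!: nonpos_Ints_cases)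
  then have "s = of_int (2 * k - n)" by (simp add: field_simps)
  then show False using assms Ints_of_int by blast
qed

text \<open>In some order x and y are s/2 and (s + 1)/2, so duplication turns \<open>Gamma s\<close>
  into Gamma(x) Gamma(y). One factor \<open>rGamma x\<close> cancels Gamma(x); reflection turns the
  other into \<open>trig\<close> times Gamma(1 - x). Excluding integers keeps all arguments off the
  poles.\<close>

lemma M_eq_P:
  assumes \<epsilon>: "\<epsilon> \<in> {0, 1}" and s: "s \<notin> \<int>"
  shows "M \<epsilon> s = P \<epsilon> s * trig \<epsilon> s"
proof -
  define x where "x = (s + of_nat \<epsilon>) / 2"
  define y where "y = (s + 1 - of_nat \<epsilon>) / 2"
  have nx: "x \<notin> \<int>\<^sub>\<le>\<^sub>0" using nonint_half[OF s, of "int \<epsilon>"] by (simp add: x_def)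
  have n1x: "1 - x \<notin> \<int>\<^sub>\<le>\<^sub>0"
  proof
    assume "1 - x \<in> \<int>\<^sub>\<le>\<^sub>0"
    then obtain k where "1 - x = of_int k" by (auto elim!: nonpos_Ints_cases)
    then have "s = of_int (2 - 2 * k - int \<epsilon>)" by (simp add: x_def field_simps)
    then show False using s Ints_of_int by blast
  qed
  have h: "s / 2 \<notin> \<int>\<^sub>\<le>\<^sub>0" "s / 2 + 1 / 2 \<notin> \<int>\<^sub>\<le>\<^sub>0"
    using nonint_half[OF s, of 0] nonint_half[OF s, of 1] by (simp_all add: add_divide_distrib)
  have "Gamma x * Gamma y = Gamma (s / 2) * Gamma (s / 2 + 1 / 2)"
    using \<epsilon> by (auto simp: x_def y_def add_divide_distrib mult.commute)
  also have "\<dots> = exp ((1 - s) * of_real (ln 2)) * of_real (sqrt pi) * Gamma s"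
    using Gamma_legendre_duplication[OF h] by simp
  also have "exp ((1 - s) * of_real (ln 2)) = 2 * 2 powr (- s)"
  proof -
    have "Ln (2 :: complex) = of_real (ln 2)" using Ln_of_real[of 2] by simp
    then have "2 powr (- s) = exp (- s * of_real (ln 2))" by (simp add: powr_def)
    moreover have "exp (complex_of_real (ln 2)) = 2" unfolding exp_of_real by simp
    ultimately show ?thesis by (simp add: left_diff_distrib exp_diff exp_minus divide_inverse)
  qed
  finally have dup: "Gamma x * Gamma y = 2 * 2 powr (- s) * of_real (sqrt pi) * Gamma s" .
  have gx: "Gamma x * rGamma x = 1" using nx by (simp add: Gamma_def rGamma_eq_zero_iff)
  have "Gamma (1 - x) * rGamma (1 - x) = 1" using n1x by (simp add: Gamma_def rGamma_eq_zero_iff)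
  then have "rGamma x = (rGamma x * rGamma (1 - x)) * Gamma (1 - x)" by (simp add: mult_ac)
  then have rx: "rGamma x = trig \<epsilon> s / of_real pi * Gamma (1 - x)"
    unfolding rGamma_reflection_complex by (simp add: trig_def x_def)
  have sp: "complex_of_real (sqrt pi) \<noteq> 0" by simp
  have "M \<epsilon> s = 2 * of_real pi ^ \<epsilon> / of_real (sqrt pi) * \<Lambda> \<epsilon> s * (2 * 2 powr (- s) * of_real (sqrt pi) * Gamma s) * rGamma x ^ 2"
    using sp by (simp add: M_def x_def field_simps)
  also have "\<dots> = 2 * of_real pi ^ \<epsilon> / of_real (sqrt pi) * \<Lambda> \<epsilon> s * Gamma y * (Gamma x * rGamma x) * rGamma x"
    unfolding dup[symmetric] by (simp add: power2_eq_square mult_ac)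
  also have "\<dots> = P \<epsilon> s * trig \<epsilon> s"
    unfolding gx unfolding rx P_def x_def[symmetric] y_def[symmetric] by (simp add: mult_ac)
  finally show ?thesis .
qed

lemma P_reflect:
  assumes "\<epsilon> \<in> {0, 1}" shows "P \<epsilon> (1 - s) = (-1) ^ \<epsilon> * P \<epsilon> s"
proof -
  have e: "(1 - s + 1 - of_nat \<epsilon>) / 2 = 1 - (s + of_nat \<epsilon>) / (2 :: complex)"
    "1 - (1 - s + of_nat \<epsilon>) / 2 = (s + 1 - of_nat \<epsilon>) / (2 :: complex)"
    by (simp_all add: field_simps)
  then show ?thesis unfolding P_def feq[OF assms] e by (simp only: mult_ac)
qed

text \<open>In \<open>M\<close> the factors 4, pi^\<epsilon> and \<open>rGamma\<close> squared undo
  \<open>gam (s + \<epsilon>)\<close>; the power of pi that remains joins 2^(-s).\<close>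

lemma M_eq_Lser:
  assumes \<epsilon>: "\<epsilon> \<in> {0, 1}" and s: "Re s > \<alpha>"
  shows "M \<epsilon> s = Gamma s * of_real (2 * pi) powr (- s) * Lser A \<epsilon> s"
proof -
  define x where "x = (s + of_nat \<epsilon>) / 2"
  have "Re x > 0" using s \<alpha> by (simp add: x_def)
  then have "x \<notin> \<int>\<^sub>\<le>\<^sub>0" by (auto elim!: nonpos_Ints_cases)
  then have gx: "Gamma x * rGamma x = 1" by (simp add: Gamma_def rGamma_eq_zero_iff)
  have p: "of_real (2 * pi) powr (- s) = 2 powr (- s) * of_real pi powr (- s)"
    using powr_times_real[of 2 "of_real pi" "- s"] by simp
  have q: "of_real pi powr (s + of_nat \<epsilon>) = of_real pi powr s * of_real pi ^ \<epsilon>"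
    by (simp add: powr_add powr_nat')
  have "M \<epsilon> s = 4 * of_real pi ^ \<epsilon> * 2 powr (- s) * (Gamma x ^ 2 / (4 * (of_real pi powr s * of_real pi ^ \<epsilon>)) * Lser A \<epsilon> s) * Gamma s * rGamma x ^ 2"
    unfolding M_def completed[OF \<epsilon> s] gam_def q x_def ..
  also have "\<dots> = (Gamma x * rGamma x) ^ 2 * (2 powr (- s) / of_real pi powr s * Lser A \<epsilon> s * Gamma s)"
    by (simp add: power_mult_distrib)
  finally show ?thesis unfolding gx p by (simp add: powr_minus divide_inverse)
qed

section \<open>Holomorphy and vertical decay of M and P\<close>

lemma holomorphic_M:
  assumes "\<epsilon> \<in> {0, 1}" shows "M \<epsilon> holomorphic_on {s. Re s > 0}"
  unfolding M_def[abs_def] using holomorphic_on_subset[OF entire[OF assms]]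
  by (auto intro!: holomorphic_intros elim!: nonpos_Ints_cases)

lemma holomorphic_P:
  assumes "\<epsilon> \<in> {0, 1}" shows "P \<epsilon> holomorphic_on {s. Im s > 0}"
  unfolding P_def[abs_def] using holomorphic_on_subset[OF entire[OF assms]]
  by (auto intro!: holomorphic_intros elim!: nonpos_Ints_cases simp: complex_eq_iff)

text \<open>On the line of absolute convergence L is bounded, Gamma decays at any rate b' < pi/2,
  and dividing \<open>M\<close> by \<open>trig\<close> gains another pi/2.\<close>

lemma P_decay_line:
  assumes \<epsilon>: "\<epsilon> \<in> {0, 1}" and b: "pi / 2 \<le> b" "b < pi"
  obtains C where "\<And>s. Re s = c \<Longrightarrow> \<bar>Im s\<bar> \<ge> 1 \<Longrightarrow> norm (P \<epsilon> s) \<le> C * exp (- b * \<bar>Im s\<bar>)"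
proof -
  define b' where "b' = b - pi / 2"
  have b': "0 \<le> b'" "b' < pi / 2" using b by (auto simp: b'_def)
  obtain C where C: "\<And>s. \<bar>Re s\<bar> \<le> c \<Longrightarrow> \<bar>Im s\<bar> \<ge> 1 \<Longrightarrow> norm (Gamma s) \<le> C * exp (- b' * \<bar>Im s\<bar>)"
    using Gamma_decay_strip[OF b'] by blast
  obtain B where B: "\<And>s. Re s = c \<Longrightarrow> norm (Lser A \<epsilon> s) \<le> B" using Lser_bound by blast
  show ?thesis
  proof (rule that)
    fix s assume s: "Re s = c" "\<bar>Im s\<bar> \<ge> 1"
    have "s \<notin> \<int>" using s(2) by (auto elim!: Ints_cases)
    then have "norm (P \<epsilon> s) * norm (trig \<epsilon> s) = norm (M \<epsilon> s)"
      using M_eq_P[OF \<epsilon>] by (simp add: norm_mult)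
    also have "\<dots> = norm (Gamma s) * (2 * pi) powr (- c) * norm (Lser A \<epsilon> s)"
      using norm_powr_real_powr[of "of_real (2 * pi)" "- s"] s c M_eq_Lser[OF \<epsilon>, of s]
      by (simp add: norm_mult)
    also have "\<dots> \<le> (C * exp (- b' * \<bar>Im s\<bar>)) * (2 * pi) powr (- c) * B"
    proof -
      have "norm (Gamma s) \<le> C * exp (- b' * \<bar>Im s\<bar>)" using s c by (intro C) auto
      moreover from order_trans[OF norm_ge_zero this] have "0 \<le> C" by (simp add: zero_le_mult_iff)
      ultimately show ?thesis using B[OF s(1)] by (intro mult_mono mult_nonneg_nonneg) auto
    qed
    finally have 1: "norm (P \<epsilon> s) * norm (trig \<epsilon> s) \<le> (C * exp (- b' * \<bar>Im s\<bar>)) * (2 * pi) powr (- c) * B" .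
    have "1 \<le> pi * \<bar>Im s\<bar> / 2"
      using mult_mono[of 2 pi 1 "\<bar>Im s\<bar>"] s(2) pi_gt3 by simp
    then have 2: "norm (trig \<epsilon> s) \<ge> exp (pi / 2 * \<bar>Im s\<bar>) / 4"
      unfolding trig_def using norm_sin_ge[of "of_real pi * ((s + of_nat \<epsilon>) / 2)"]
      by (simp add: abs_mult)
    have "norm (P \<epsilon> s) * (exp (pi / 2 * \<bar>Im s\<bar>) / 4) \<le> (C * exp (- b' * \<bar>Im s\<bar>)) * (2 * pi) powr (- c) * B"
      using mult_left_mono[OF 2, of "norm (P \<epsilon> s)"] 1 by simp
    then have "norm (P \<epsilon> s) * (exp (pi / 2 * \<bar>Im s\<bar>) / 4) * (4 * exp (- (pi / 2 * \<bar>Im s\<bar>))) \<le> (C * exp (- b' * \<bar>Im s\<bar>)) * (2 * pi) powr (- c) * B * (4 * exp (- (pi / 2 * \<bar>Im s\<bar>)))"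
      by (rule mult_right_mono) simp
    also have "norm (P \<epsilon> s) * (exp (pi / 2 * \<bar>Im s\<bar>) / 4) * (4 * exp (- (pi / 2 * \<bar>Im s\<bar>))) = norm (P \<epsilon> s)"
      by (simp add: exp_minus)
    also have "(C * exp (- b' * \<bar>Im s\<bar>)) * (2 * pi) powr (- c) * B * (4 * exp (- (pi / 2 * \<bar>Im s\<bar>)))
      = 4 * C * (2 * pi) powr (- c) * B * (exp (- b' * \<bar>Im s\<bar>) * exp (- (pi / 2 * \<bar>Im s\<bar>)))"
      by (simp only: mult_ac)
    also have "exp (- b' * \<bar>Im s\<bar>) * exp (- (pi / 2 * \<bar>Im s\<bar>)) = exp (- b * \<bar>Im s\<bar>)"
      unfolding exp_add[symmetric] by (rule arg_cong[of _ _ exp]) (simp add: b'_def algebra_simps)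
    finally show "norm (P \<epsilon> s) \<le> 4 * C * (2 * pi) powr (- c) * B * exp (- b * \<bar>Im s\<bar>)" .
  qed
qed

lemma norm_P_reflect: "\<epsilon> \<in> {0, 1} \<Longrightarrow> norm (P \<epsilon> (1 - s)) = norm (P \<epsilon> s)"
  by (simp add: P_reflect norm_mult norm_power)

text \<open>The left edge Re s = 1 - c is the mirror image of the right one under the symmetry of
  \<open>P\<close>. Inside, the finite order of \<Lambda> and the boundedness of the Gamma factors
  supply the a priori growth for Phragmen-Lindelof.\<close>

lemma P_decay_strip':
  assumes \<epsilon>: "\<epsilon> \<in> {0, 1}" and b: "pi / 2 \<le> b" "b < pi"
  obtains C where "\<And>s. 1 - c \<le> Re s \<Longrightarrow> Re s \<le> c \<Longrightarrow> \<bar>Im s\<bar> \<ge> 1 \<Longrightarrow> norm (P \<epsilon> s) \<le> C * exp (- b * \<bar>Im s\<bar>)"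
proof -
  have b0: "b \<ge> 0" using b pi_gt_zero by linarith
  obtain C1 where C1: "\<And>s. Re s = c \<Longrightarrow> \<bar>Im s\<bar> \<ge> 1 \<Longrightarrow> norm (P \<epsilon> s) \<le> C1 * exp (- b * \<bar>Im s\<bar>)"
    using P_decay_line[OF \<epsilon> b] by blast
  let ?seg = "cbox (Complex (1 - c) 1) (Complex c 1)"
  have "continuous_on ?seg (P \<epsilon>)"
    using holomorphic_on_imp_continuous_on[OF holomorphic_P[OF \<epsilon>]]
    by (rule continuous_on_subset) (auto simp: in_cbox_complex_iff)
  then have "bounded (P \<epsilon> ` ?seg)" by (intro compact_imp_bounded compact_continuous_image) auto
  then obtain B where "\<forall>x\<in>P \<epsilon> ` ?seg. norm x \<le> B" unfolding bounded_iff by blast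
  then have B: "norm (P \<epsilon> s) \<le> B" if "1 - c \<le> Re s" "Re s \<le> c" "Im s = 1" for s
    using that by (auto simp: in_cbox_complex_iff)
  \<comment> \<open>Both Gamma arguments in \<open>P\<close> have imaginary part of size |Im z| / 2
    >= 1/2; the half-width c + 2 generously covers their real parts.\<close>
  obtain G1 where G1: "\<And>z. \<bar>Re z\<bar> \<le> c + 2 \<Longrightarrow> \<bar>Im z\<bar> \<ge> 1 / 2 \<Longrightarrow> norm (Gamma z) \<le> G1"
    using Gamma_bounded_strip[of "1 / 2" "c + 2"] by (metis half_gt_zero zero_less_one)
  obtain \<rho> R where R: "\<And>z. norm z \<ge> R \<Longrightarrow> norm (\<Lambda> \<epsilon> z) \<le> exp (norm z powr \<rho>)"
    using order[OF \<epsilon>] unfolding finite_order_def by blast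
  define \<kappa> where "\<kappa> = norm (2 * of_real pi ^ \<epsilon> / (of_real pi * of_real (sqrt pi)) :: complex)"
  define C where "C = max C1 (B * exp b)"
  let ?G = "\<lambda>s. P \<epsilon> s * exp (- \<i> * of_real b * s)"
  have nG: "norm (?G z) = norm (P \<epsilon> z) * exp (b * Im z)" for z by (simp add: norm_mult)
  have conv: "norm (?G z) \<le> C'" if "norm (P \<epsilon> z) \<le> C' * exp (- b * Im z)" for z C'
  proof -
    have "norm (?G z) \<le> C' * exp (- b * Im z) * exp (b * Im z)"
      unfolding nG using that by (rule mult_right_mono) simp
    also have "C' * exp (- b * Im z) * exp (b * Im z) = C'" by (simp add: exp_minus)
    finally show ?thesis .
  qed
  have up: "norm (P \<epsilon> s) \<le> C * exp (- b * Im s)" if s: "1 - c \<le> Re s" "Re s \<le> c" "1 \<le> Im s" for s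
  proof -
    have "norm (?G s) \<le> C"
    proof (rule phragmen_lindelof_half_strip[where G = ?G and s = s and a = "1 - c" and b = c and \<tau> = 1
          and U = "{z. Im z > 0}" and \<tau>' = "max 1 R" and C = "\<kappa> * G1 * G1" and \<rho> = \<rho> and D = b])
      show "?G holomorphic_on {z. Im z > 0}"
        by (intro holomorphic_intros holomorphic_P \<epsilon>)
      show "open {z. Im z > 0}" by (rule open_halfspace_Im_gt)
      fix z assume z: "1 - c \<le> Re z" "Re z \<le> c"
      show "norm (?G z) \<le> C" if "1 \<le> Im z" "Re z = 1 - c \<or> Re z = c \<or> Im z = 1"
        using that(2)
      proof (elim disjE)
        assume "Re z = 1 - c"
        then have "norm (P \<epsilon> z) \<le> C1 * exp (- b * Im z)"
          using C1[of "1 - z"] that norm_P_reflect[OF \<epsilon>, of z] by simp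
        from conv[OF this] show ?thesis by (simp add: C_def)
      next
        assume "Re z = c"
        then have "norm (P \<epsilon> z) \<le> C1 * exp (- b * Im z)" using C1[of z] that by simp
        from conv[OF this] show ?thesis by (simp add: C_def)
      next
        assume i: "Im z = 1"
        have "norm (?G z) \<le> B * exp b" unfolding nG using B[OF z i] i by simp
        then show ?thesis by (simp add: C_def)
      qed
      assume "max 1 R \<le> Im z"
      then have i: "1 \<le> Im z" "R \<le> norm z" using abs_Im_le_cmod[of z] by auto
      have "norm (P \<epsilon> z) = \<kappa> * norm (\<Lambda> \<epsilon> z) * norm (Gamma ((z + 1 - of_nat \<epsilon>) / 2)) * norm (Gamma (1 - (z + of_nat \<epsilon>) / 2))"
        unfolding P_def norm_mult \<kappa>_def ..
      also have "\<dots> \<le> \<kappa> * exp (norm z powr \<rho>) * G1 * G1"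
      proof (intro mult_mono)
        show "norm (\<Lambda> \<epsilon> z) \<le> exp (norm z powr \<rho>)" by (rule R[OF i(2)])
        show "norm (Gamma ((z + 1 - of_nat \<epsilon>) / 2)) \<le> G1" using z i c \<epsilon> by (intro G1) (auto simp: abs_le_iff field_simps)
        show "norm (Gamma (1 - (z + of_nat \<epsilon>) / 2)) \<le> G1" using z i c \<epsilon> by (intro G1) (auto simp: abs_le_iff field_simps)
        then have "0 \<le> G1" using norm_ge_zero order_trans by blast
        then show "0 \<le> \<kappa> * exp (norm z powr \<rho>) * G1" by (simp add: \<kappa>_def)
      qed (auto simp: \<kappa>_def)
      finally have 1: "norm (P \<epsilon> z) \<le> \<kappa> * exp (norm z powr \<rho>) * G1 * G1" .
      have 2: "exp (b * Im z) \<le> exp (b * norm z)"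
        using mult_left_mono[OF order_trans[OF abs_ge_self abs_Im_le_cmod[of z]] b0] by simp
      have "norm (?G z) \<le> (\<kappa> * exp (norm z powr \<rho>) * G1 * G1) * exp (b * norm z)"
        unfolding nG using 1 2 by (intro mult_mono) (auto intro: order_trans[OF norm_ge_zero])
      then show "norm (?G z) \<le> \<kappa> * G1 * G1 * exp (norm z powr \<rho> + b * norm z)"
        by (simp add: exp_add mult_ac)
    qed (use s in auto)
    then have "norm (P \<epsilon> s) * exp (b * Im s) * exp (- b * Im s) \<le> C * exp (- b * Im s)"
      unfolding nG by (rule mult_right_mono) simp
    also have "norm (P \<epsilon> s) * exp (b * Im s) * exp (- b * Im s) = norm (P \<epsilon> s)"
      by (simp add: exp_minus)
    finally show ?thesis .
  qed
  show ?thesis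
  proof (rule that)
    fix s assume s: "1 - c \<le> Re s" "Re s \<le> c" "\<bar>Im s\<bar> \<ge> 1"
    show "norm (P \<epsilon> s) \<le> C * exp (- b * \<bar>Im s\<bar>)"
    proof (cases "Im s \<ge> 0")
      case True
      then show ?thesis using up[of s] s by simp
    next
      case False
      \<comment> \<open>For complex coefficients conjugation is no symmetry of \<open>P\<close>, but
        s -> 1 - s also exchanges upper and lower half-strips.\<close>
      then show ?thesis using up[of "1 - s"] s norm_P_reflect[OF \<epsilon>, of s] by simp
    qed
  qed
qed

lemma P_decay_strip:
  assumes \<epsilon>: "\<epsilon> \<in> {0, 1}" and b: "b < pi"
  obtains C where "\<And>s. 1 - c \<le> Re s \<Longrightarrow> Re s \<le> c \<Longrightarrow> \<bar>Im s\<bar> \<ge> 1 \<Longrightarrow> norm (P \<epsilon> s) \<le> C * exp (- b * \<bar>Im s\<bar>)"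
proof -
  define b' where "b' = max b (pi / 2)"
  have b': "pi / 2 \<le> b'" "b' < pi" "b \<le> b'" using b by (auto simp: b'_def)
  obtain C where C: "\<And>s. 1 - c \<le> Re s \<Longrightarrow> Re s \<le> c \<Longrightarrow> \<bar>Im s\<bar> \<ge> 1 \<Longrightarrow> norm (P \<epsilon> s) \<le> C * exp (- b' * \<bar>Im s\<bar>)"
    using P_decay_strip'[OF \<epsilon> b'(1,2)] by blast
  show ?thesis
  proof (rule that)
    fix s assume s: "1 - c \<le> Re s" "Re s \<le> c" "\<bar>Im s\<bar> \<ge> 1"
    have "norm (P \<epsilon> s) \<le> C * exp (- b' * \<bar>Im s\<bar>)" by (rule C[OF s])
    also have "\<dots> \<le> max C 0 * exp (- b * \<bar>Im s\<bar>)"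
      using b'(3) by (intro mult_mono) (auto intro: mult_right_mono)
    finally show "norm (P \<epsilon> s) \<le> max C 0 * exp (- b * \<bar>Im s\<bar>)" .
  qed
qed

text \<open>The growth of \<open>trig\<close> costs pi/2. The rates that remain are those needed for
  w = log(-i y), where |Im w| < pi/2.\<close>

lemma M_decay_strip:
  assumes \<epsilon>: "\<epsilon> \<in> {0, 1}" and b: "b < pi / 2"
  obtains C where "\<And>s. 1 - c \<le> Re s \<Longrightarrow> Re s \<le> c \<Longrightarrow> \<bar>Im s\<bar> \<ge> 1 \<Longrightarrow> norm (M \<epsilon> s) \<le> C * exp (- b * \<bar>Im s\<bar>)"
proof -
  have "b + pi / 2 < pi" using b by simp
  then obtain C where C: "\<And>s. 1 - c \<le> Re s \<Longrightarrow> Re s \<le> c \<Longrightarrow> \<bar>Im s\<bar> \<ge> 1 \<Longrightarrow>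
      norm (P \<epsilon> s) \<le> C * exp (- (b + pi / 2) * \<bar>Im s\<bar>)"
    using P_decay_strip[OF \<epsilon>] by blast
  show ?thesis
  proof (rule that)
    fix s assume s: "1 - c \<le> Re s" "Re s \<le> c" "\<bar>Im s\<bar> \<ge> 1"
    have "s \<notin> \<int>" using s(3) by (auto elim!: Ints_cases)
    then have "norm (M \<epsilon> s) = norm (P \<epsilon> s) * norm (trig \<epsilon> s)"
      using M_eq_P[OF \<epsilon>] by (simp add: norm_mult)
    also have "norm (trig \<epsilon> s) \<le> exp (pi / 2 * \<bar>Im s\<bar>)"
      unfolding trig_def using norm_sin_le[of "of_real pi * ((s + of_nat \<epsilon>) / 2)"]
      by (simp add: abs_mult)
    then have "norm (P \<epsilon> s) * norm (trig \<epsilon> s) \<le> (C * exp (- (b + pi / 2) * \<bar>Im s\<bar>)) * exp (pi / 2 * \<bar>Im s\<bar>)"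
      using C[OF s] by (intro mult_mono) (auto intro: order_trans[OF norm_ge_zero])
    also have "\<dots> = C * exp (- b * \<bar>Im s\<bar>)"
      unfolding mult.assoc exp_add[symmetric] by (simp add: algebra_simps)
    finally show "norm (M \<epsilon> s) \<le> C * exp (- b * \<bar>Im s\<bar>)" .
  qed
qed

subsection \<open>Splitting the exponential series\<close>

definition V_kernel :: "complex \<Rightarrow> complex" where
  "V_kernel s = (\<i> * P 0 s + P 1 s) / 4"

definition U_kernel :: "complex \<Rightarrow> complex" where
  "U_kernel s = (- \<i> * P 0 s + P 1 s) / 4"

lemma kernel_reflect: "V_kernel (1 - s) = - U_kernel s" "U_kernel (1 - s) = - V_kernel s"
  by (simp_all add: V_kernel_def U_kernel_def P_reflect field_simps)

text \<open>In the open critical strip both Gamma arguments have positive real part, for either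
  \<epsilon>.\<close>

lemma P_critical_line:
  assumes \<epsilon>: "\<epsilon> \<in> {0, 1}" and b: "0 \<le> b" "b < pi"
  shows "continuous_on UNIV (\<lambda>t. P \<epsilon> (Complex (1 / 2) t))"
    and "\<exists>C. \<forall>t. norm (P \<epsilon> (Complex (1 / 2) t)) \<le> C * exp (- b * \<bar>t\<bar>)"
proof -
  have "P \<epsilon> holomorphic_on {s. 0 < Re s \<and> Re s < 1}"
    unfolding P_def[abs_def]
    by (intro holomorphic_intros holomorphic_on_subset[OF entire[OF \<epsilon>]] not_nonpos_Int_if_Re_pos)
      (use \<epsilon> in \<open>auto simp: field_simps\<close>)
  then show cont: "continuous_on UNIV (\<lambda>t. P \<epsilon> (Complex (1 / 2) t))"
    by (rule continuous_on_Complex_line) simp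
  obtain C where C: "\<And>s. 1 - c \<le> Re s \<Longrightarrow> Re s \<le> c \<Longrightarrow> \<bar>Im s\<bar> \<ge> 1 \<Longrightarrow> norm (P \<epsilon> s) \<le> C * exp (- b * \<bar>Im s\<bar>)"
    using P_decay_strip[OF \<epsilon> b(2)] by blast
  have "norm (P \<epsilon> (Complex (1 / 2) t)) \<le> C * exp (- b * \<bar>t\<bar>)" if "\<bar>t\<bar> \<ge> 1" for t
    using C[of "Complex (1 / 2) t"] that c by simp
  then show "\<exists>C. \<forall>t. norm (P \<epsilon> (Complex (1 / 2) t)) \<le> C * exp (- b * \<bar>t\<bar>)"
    using exp_decay_extend[OF cont _ b(1)] by metis
qed

lemma kernel_critical_line:
  assumes b: "0 \<le> b" "b < pi" and k: "k = V_kernel \<or> k = U_kernel"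
  shows "continuous_on UNIV (\<lambda>t. k (Complex (1 / 2) t))"
    and "\<exists>C. \<forall>t. norm (k (Complex (1 / 2) t)) \<le> C * exp (- b * \<bar>t\<bar>)"
proof -
  have cont: "continuous_on UNIV (\<lambda>t. P \<epsilon> (Complex (1 / 2) t))" if "\<epsilon> \<in> {0, 1}" for \<epsilon>
    using P_critical_line(1)[OF that b] .
  show "continuous_on UNIV (\<lambda>t. k (Complex (1 / 2) t))"
    using k by (auto simp: V_kernel_def U_kernel_def intro!: continuous_intros cont)
  obtain C0 where C0: "\<And>t. norm (P 0 (Complex (1 / 2) t)) \<le> C0 * exp (- b * \<bar>t\<bar>)"
    using P_critical_line(2)[OF _ b, of 0] by auto
  obtain C1 where C1: "\<And>t. norm (P 1 (Complex (1 / 2) t)) \<le> C1 * exp (- b * \<bar>t\<bar>)"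
    using P_critical_line(2)[OF _ b, of 1] by auto
  have "norm (k (Complex (1 / 2) t)) \<le> (C0 + C1) / 4 * exp (- b * \<bar>t\<bar>)" for t
  proof -
    let ?s = "Complex (1 / 2) t"
    have "norm (k ?s) \<le> (norm (P 0 ?s) + norm (P 1 ?s)) / 4"
      using k norm_triangle_ineq[of "\<i> * P 0 ?s" "P 1 ?s"] norm_triangle_ineq[of "- \<i> * P 0 ?s" "P 1 ?s"]
      by (auto simp: V_kernel_def U_kernel_def norm_divide norm_mult)
    also have "\<dots> \<le> (C0 * exp (- b * \<bar>t\<bar>) + C1 * exp (- b * \<bar>t\<bar>)) / 4"
      by (intro divide_right_mono add_mono C0 C1) simp
    finally show ?thesis by (simp add: algebra_simps)
  qed
  then show "\<exists>C. \<forall>t. norm (k (Complex (1 / 2) t)) \<le> C * exp (- b * \<bar>t\<bar>)" by blast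
qed

text \<open>At w = log y this is the inverse Mellin integral of k(s) y^(-s) over Re s = 1/2; the i
  of ds = i dt cancels the one in 2 pi i. Taking the logarithm as the variable keeps the choice of
  branch explicit.\<close>

definition transform :: "(complex \<Rightarrow> complex) \<Rightarrow> complex \<Rightarrow> complex" where
  "transform k w = (LINT t|lborel. k (Complex (1 / 2) t) * exp (- (Complex (1 / 2) t) * w)) / (2 * of_real pi)"

lemma integrable_transform:
  assumes k: "k = V_kernel \<or> k = U_kernel" and w: "\<bar>Im w\<bar> < pi"
  shows "integrable lborel (\<lambda>t. k (Complex (1 / 2) t) * exp (- (Complex (1 / 2) t) * w))"
proof -
  define b where "b = (\<bar>Im w\<bar> + pi) / 2"
  have b: "0 \<le> b" "b < pi" "\<bar>Im w\<bar> < b" using w by (auto simp: b_def)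
  obtain C where C: "\<And>t. norm (k (Complex (1 / 2) t)) \<le> C * exp (- b * \<bar>t\<bar>)"
    using kernel_critical_line(2)[OF b(1,2) k] by blast
  show ?thesis by (rule integrable_exp_transform[OF kernel_critical_line(1)[OF b(1,2) k] C b(3)])
qed

lemma transform_holomorphic:
  assumes k: "k = V_kernel \<or> k = U_kernel"
  shows "transform k holomorphic_on {w. \<bar>Im w\<bar> < pi}"
proof -
  have "transform k field_differentiable (at w)" if w: "\<bar>Im w\<bar> < pi" for w
  proof -
    define b where "b = (\<bar>Im w\<bar> + pi) / 2"
    have b: "0 \<le> b" "b < pi" "\<bar>Im w\<bar> < b" using w by (auto simp: b_def)
    obtain C where C: "\<And>t. norm (k (Complex (1 / 2) t)) \<le> C * exp (- b * \<bar>t\<bar>)"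
      using kernel_critical_line(2)[OF b(1,2) k] by blast
    show ?thesis unfolding transform_def[abs_def] field_differentiable_def
      using DERIV_cdivide[OF has_field_derivative_exp_transform[OF kernel_critical_line(1)[OF b(1,2) k] C b(3)]]
      by blast
  qed
  then show ?thesis by (auto simp: holomorphic_on_def intro: field_differentiable_at_within)
qed

text \<open>The principal logarithm maps the slit plane into the strip |Im w| < pi, which is the
  strip where the decay of the kernels makes the integral converge.\<close>

lemma transform_Ln_holomorphic:
  assumes k: "k = V_kernel \<or> k = U_kernel"
  shows "(\<lambda>y. transform k (Ln y)) holomorphic_on (- \<real>\<^sub>\<le>\<^sub>0)"
proof -
  have "(transform k \<circ> Ln) holomorphic_on (- \<real>\<^sub>\<le>\<^sub>0)"
  proof (rule holomorphic_on_compose_gen[OF _ transform_holomorphic[OF k]])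
    show "Ln holomorphic_on (- \<real>\<^sub>\<le>\<^sub>0)" by (intro holomorphic_intros) auto
    have "\<bar>Im (Ln y)\<bar> < pi" if "y \<notin> \<real>\<^sub>\<le>\<^sub>0" for y
    proof -
      have "y \<noteq> 0" using that by auto
      moreover have "Im (Ln y) \<noteq> pi"
        using that Im_Ln_eq_pi[OF \<open>y \<noteq> 0\<close>] by (auto simp: complex_nonpos_Reals_iff)
      ultimately show ?thesis using mpi_less_Im_Ln[of y] Im_Ln_le_pi[of y] by (auto simp: abs_less_iff)
    qed
    then show "Ln ` (- \<real>\<^sub>\<le>\<^sub>0) \<subseteq> {w. \<bar>Im w\<bar> < pi}" by auto
  qed
  then show ?thesis by (simp add: o_def)
qed

text \<open>On Re s = 1/2 the substitution t -> -t is s -> 1 - s. The extra factor exp w is y, the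
  automorphy factor of weight one.\<close>

lemma transform_reflect:
  assumes "\<And>s. k (1 - s) = - k' s"
  shows "transform k (- w) = - exp w * transform k' w"
proof -
  let ?g = "\<lambda>t. k (Complex (1 / 2) t) * exp (- (Complex (1 / 2) t) * (- w))"
  have "(LINT t|lborel. ?g t) = \<bar>- 1 :: real\<bar> *\<^sub>R (LINT t|lborel. ?g (0 + (- 1) * t))"
    by (rule lborel_integral_real_affine) simp
  also have "\<dots> = (LINT t|lborel. - exp w * (k' (Complex (1 / 2) t) * exp (- (Complex (1 / 2) t) * w)))"
  proof -
    have "?g (0 + (- 1) * t) = - exp w * (k' (Complex (1 / 2) t) * exp (- (Complex (1 / 2) t) * w))" for t
    proof -
      have e: "Complex (1 / 2) (0 + (- 1) * t) = 1 - Complex (1 / 2) t" by (simp add: complex_eq_iff)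
      have "exp (- (1 - Complex (1 / 2) t) * (- w)) = exp w * exp (- (Complex (1 / 2) t) * w)"
        by (simp flip: exp_add add: algebra_simps)
      then show ?thesis unfolding e assms by simp
    qed
    then show ?thesis by simp
  qed
  also have "\<dots> = - exp w * (LINT t|lborel. k' (Complex (1 / 2) t) * exp (- (Complex (1 / 2) t) * w))"
    by (rule integral_mult_right_zero)
  finally show ?thesis unfolding transform_def by simp
qed

text \<open>The series is a Mellin integral at w = log(-i y) over Re s = c. Moved to the critical
  line, it splits because the exponentials in sine and cosine rotate y^(-s) to y^(-s) and (-y)^(-s)
  with principal branches.\<close>

lemma fA_upper:
  assumes y: "y \<in> upper_hp"
  shows "fA A y = transform V_kernel (Ln y) + transform U_kernel (Ln (- y))"
proof -
  have Imy: "Im y > 0" and ynz: "y \<noteq> 0" using y by (auto simp: upper_hp_def)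
  \<comment> \<open>Thus y = i exp w, and rotating by a right angle turns 0 < Im (Ln y) < pi into
    |Im w| < pi/2.\<close>
  define w where "w = Ln y - \<i> * of_real pi / 2"
  have ImLn: "0 < Im (Ln y)" "Im (Ln y) < pi" using Im_Ln_pos_lt_imp[OF Imy] by auto
  then have w: "\<bar>Im w\<bar> < pi / 2" unfolding w_def by (simp only: abs_less_iff) simp
  have ew: "exp w = - \<i> * y"
  proof -
    have "exp (\<i> * of_real pi / 2) = \<i>" by (simp add: exp_eq_polar complex_eq_iff)
    then show ?thesis using ynz by (simp add: w_def exp_diff)
  qed
  have Lm: "Ln (- y) = Ln y - \<i> * of_real pi"
    using Ln_minus[OF ynz] Imy by simp
  define F where "F s = (M 0 s + M 1 s) / 2 * exp (- s * w)" for s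
  have "(\<lambda>m. A (int m + 1) * exp (- 2 * of_real pi * of_nat (m + 1) * exp w)) sums
     ((LINT t|lborel. Gamma (Complex c t) * of_real (2 * pi) powr (- (Complex c t))
         * (\<Sum>m. A (int m + 1) / of_nat (m + 1) powr (Complex c t)) * exp (- (Complex c t) * w)) / (2 * of_real pi))"
    by (rule exp_series_eq_transform[OF c(2) abs_summable_coeff(1) w])
  also have "(\<lambda>t. Gamma (Complex c t) * of_real (2 * pi) powr (- (Complex c t))
         * (\<Sum>m. A (int m + 1) / of_nat (m + 1) powr (Complex c t)) * exp (- (Complex c t) * w)) = (\<lambda>t. F (Complex c t))"
  proof
    fix t
    have 1: "(\<Sum>m. A (int m + 1) / of_nat (m + 1) powr (Complex c t)) = (Lser A 0 (Complex c t) + Lser A 1 (Complex c t)) / 2"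
      by (rule Lser_half_sum) simp
    have M: "M \<epsilon> (Complex c t) = Gamma (Complex c t) * of_real (2 * pi) powr (- (Complex c t)) * Lser A \<epsilon> (Complex c t)"
      if "\<epsilon> \<in> {0, 1}" for \<epsilon> using that c by (intro M_eq_Lser) auto
    show "Gamma (Complex c t) * of_real (2 * pi) powr (- (Complex c t))
         * (\<Sum>m. A (int m + 1) / of_nat (m + 1) powr (Complex c t)) * exp (- (Complex c t) * w) = F (Complex c t)"
      unfolding 1 F_def M[OF insertI1] M[OF insertI2[OF singletonI]] by (simp add: distrib_left distrib_right add_divide_distrib)
  qed
  finally have s1: "(\<lambda>m. A (int m + 1) * exp (- 2 * of_real pi * of_nat (m + 1) * exp w)) sums
     ((LINT t|lborel. F (Complex c t)) / (2 * of_real pi))" .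
  have "fA A y = (\<Sum>m. A (int m + 1) * exp (- 2 * of_real pi * of_nat (m + 1) * exp w))"
    using Imy by (simp add: fA_def ew mult_ac)
  also have "\<dots> = (LINT t|lborel. F (Complex c t)) / (2 * of_real pi)"
    using s1 by (rule sums_unique[symmetric])
  \<comment> \<open>No residue appears, as \<open>M\<close> is holomorphic for Re s > 0. The rate b
    is taken between |Im w|, so that the integrand decays, and pi/2, the limit for
    \<open>M\<close>.\<close>
  also have "(LINT t|lborel. F (Complex c t)) = (LINT t|lborel. F (Complex (1 / 2) t))"
  proof -
    define b where "b = (\<bar>Im w\<bar> + pi / 2) / 2"
    have b: "b < pi / 2" "\<bar>Im w\<bar> < b" using w by (auto simp: b_def field_simps)
    obtain C0 where C0: "\<And>s. 1 - c \<le> Re s \<Longrightarrow> Re s \<le> c \<Longrightarrow> \<bar>Im s\<bar> \<ge> 1 \<Longrightarrow> norm (M 0 s) \<le> C0 * exp (- b * \<bar>Im s\<bar>)"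
      using M_decay_strip[OF _ b(1), of 0] by auto
    obtain C1 where C1: "\<And>s. 1 - c \<le> Re s \<Longrightarrow> Re s \<le> c \<Longrightarrow> \<bar>Im s\<bar> \<ge> 1 \<Longrightarrow> norm (M 1 s) \<le> C1 * exp (- b * \<bar>Im s\<bar>)"
      using M_decay_strip[OF _ b(1), of 1] by auto
    show ?thesis
    proof (rule vertical_line_shift_holomorphic[where S = "{s. Re s > 0}" and F = F
          and C = "(C0 + C1) / 2 * exp (c * \<bar>Re w\<bar>)" and \<delta> = "b - \<bar>Im w\<bar>"])
      show "F holomorphic_on {s. Re s > 0}"
        unfolding F_def[abs_def] by (intro holomorphic_intros holomorphic_M) auto
      show "convex {s. Re s > 0}" by (rule convex_halfspace_Re_gt)
      fix s assume s: "1 / 2 \<le> Re s" "Re s \<le> c" "1 \<le> \<bar>Im s\<bar>"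
      have cs: "1 - c \<le> Re s" using s c by simp
      have "norm ((M 0 s + M 1 s) / 2) \<le> (norm (M 0 s) + norm (M 1 s)) / 2"
        using norm_triangle_ineq[of "M 0 s" "M 1 s"] by (simp add: norm_divide)
      also have "\<dots> \<le> (C0 * exp (- b * \<bar>Im s\<bar>) + C1 * exp (- b * \<bar>Im s\<bar>)) / 2"
        by (intro divide_right_mono add_mono C0 C1 cs s) simp
      finally have n1: "norm ((M 0 s + M 1 s) / 2) \<le> (C0 + C1) / 2 * exp (- b * \<bar>Im s\<bar>)"
        by (simp add: algebra_simps)
      have "Re (- s * w) \<le> c * \<bar>Re w\<bar> + \<bar>Im w\<bar> * \<bar>Im s\<bar>"
      proof -
        have "- (Re s * Re w) \<le> \<bar>Re s\<bar> * \<bar>Re w\<bar>" using abs_ge_self[of "- (Re s * Re w)"] by (simp add: abs_mult)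
        also have "\<dots> \<le> c * \<bar>Re w\<bar>" using s by (intro mult_right_mono) auto
        finally have "- (Re s * Re w) \<le> c * \<bar>Re w\<bar>" .
        moreover have "Im s * Im w \<le> \<bar>Im w\<bar> * \<bar>Im s\<bar>"
          using abs_ge_self[of "Im s * Im w"] by (simp add: abs_mult mult.commute)
        ultimately show ?thesis by simp
      qed
      then have n2: "norm (exp (- s * w)) \<le> exp (c * \<bar>Re w\<bar> + \<bar>Im w\<bar> * \<bar>Im s\<bar>)" by simp
      have "norm (F s) \<le> ((C0 + C1) / 2 * exp (- b * \<bar>Im s\<bar>)) * exp (c * \<bar>Re w\<bar> + \<bar>Im w\<bar> * \<bar>Im s\<bar>)"
        unfolding F_def norm_mult using order_trans[OF norm_ge_zero n1]
        by (intro mult_mono n1 n2) auto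
      also have "\<dots> = (C0 + C1) / 2 * exp (c * \<bar>Re w\<bar>) * (exp (- b * \<bar>Im s\<bar>) * exp (\<bar>Im w\<bar> * \<bar>Im s\<bar>))"
        by (simp only: exp_add mult_ac)
      also have "exp (- b * \<bar>Im s\<bar>) * exp (\<bar>Im w\<bar> * \<bar>Im s\<bar>) = exp (- (b - \<bar>Im w\<bar>) * \<bar>Im s\<bar>)"
        unfolding exp_add[symmetric] by (rule arg_cong[of _ _ exp]) (simp add: algebra_simps)
      finally show "norm (F s) \<le> (C0 + C1) / 2 * exp (c * \<bar>Re w\<bar>) * exp (- (b - \<bar>Im w\<bar>) * \<bar>Im s\<bar>)" .
    qed (use b c in auto)
  qed
  also have "(\<lambda>t. F (Complex (1 / 2) t)) = (\<lambda>t. V_kernel (Complex (1 / 2) t) * exp (- (Complex (1 / 2) t) * Ln y)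
      + U_kernel (Complex (1 / 2) t) * exp (- (Complex (1 / 2) t) * Ln (- y)))"
  proof
    fix t
    define s where "s = Complex (1 / 2) t"
    have "s \<notin> \<int>"
    proof
      assume "s \<in> \<int>"
      then obtain n where "s = of_int n" by (auto elim: Ints_cases)
      then have "1 / 2 = real_of_int n" by (simp add: s_def complex_eq_iff)
      then have "real_of_int (2 * n) = real_of_int 1" by simp
      then have "2 * n = 1" by (simp only: of_int_eq_iff)
      then show False by presburger
    qed
    then have MP: "M 0 s = P 0 s * trig 0 s" "M 1 s = P 1 s * trig 1 s" by (simp_all add: M_eq_P)
    \<comment> \<open>Since exp(-s w) is e times exp(-s Ln y), the 1/e in sine and cosine gives
      exp(-s Ln y), while their e gives e^2 exp(-s Ln y), which is exp(-s Ln (-y)) because Ln (-y) =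
      Ln y - i pi here.\<close>
    define e where "e = exp (\<i> * of_real pi * s / 2)"
    have enz: "e \<noteq> 0" by (simp add: e_def)
    have t0: "trig 0 s = (e - inverse e) / (2 * \<i>)"
      by (simp add: trig_def sin_exp_eq e_def exp_minus[symmetric] mult_ac)
    have "trig 1 s = sin (of_real pi * s / 2 + of_real pi / 2)"
      by (simp add: trig_def algebra_simps add_divide_distrib)
    also have "\<dots> = cos (of_real pi * s / 2)" by (simp add: sin_add)
    finally have t1: "trig 1 s = (e + inverse e) / 2"
      by (simp add: cos_exp_eq e_def exp_minus[symmetric] mult_ac)
    have x1: "exp (- s * w) = e * exp (- s * Ln y)"
      unfolding e_def exp_add[symmetric] by (rule arg_cong[of _ _ exp]) (simp add: w_def algebra_simps)
    have x2: "exp (- s * Ln (- y)) = e * e * exp (- s * Ln y)"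
      unfolding e_def exp_add[symmetric] Lm by (rule arg_cong[of _ _ exp]) (simp add: algebra_simps)
    have "F s = V_kernel s * exp (- s * Ln y) + U_kernel s * exp (- s * Ln (- y))"
      unfolding F_def MP t0 t1 x1 x2 V_kernel_def U_kernel_def using enz by (simp add: field_simps)
    then show "F (Complex (1 / 2) t) = V_kernel (Complex (1 / 2) t) * exp (- (Complex (1 / 2) t) * Ln y)
      + U_kernel (Complex (1 / 2) t) * exp (- (Complex (1 / 2) t) * Ln (- y))" by (simp only: s_def)
  qed
  also have "(LINT t|lborel. V_kernel (Complex (1 / 2) t) * exp (- (Complex (1 / 2) t) * Ln y)
      + U_kernel (Complex (1 / 2) t) * exp (- (Complex (1 / 2) t) * Ln (- y)))
    = (LINT t|lborel. V_kernel (Complex (1 / 2) t) * exp (- (Complex (1 / 2) t) * Ln y))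
      + (LINT t|lborel. U_kernel (Complex (1 / 2) t) * exp (- (Complex (1 / 2) t) * Ln (- y)))"
    using ImLn by (intro Bochner_Integration.integral_add integrable_transform) (auto simp: Lm)
  finally show ?thesis by (simp add: transform_def add_divide_distrib)
qed

text \<open>Read off the splitting, both parts of which are holomorphic on the upper
  half-plane.\<close>

lemma fA_analytic_upper: "fA A analytic_on upper_hp"
proof -
  have op: "open upper_hp" unfolding upper_hp_def by (rule open_halfspace_Im_gt)
  have sub: "upper_hp \<subseteq> - \<real>\<^sub>\<le>\<^sub>0" "uminus ` upper_hp \<subseteq> - \<real>\<^sub>\<le>\<^sub>0"
    by (auto simp: upper_hp_def complex_nonpos_Reals_iff)
  have "((\<lambda>y. transform U_kernel (Ln y)) \<circ> uminus) holomorphic_on upper_hp"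
    by (rule holomorphic_on_compose_gen[OF _ transform_Ln_holomorphic sub(2)]) (auto intro: holomorphic_intros)
  then have "(\<lambda>y. transform V_kernel (Ln y) + transform U_kernel (Ln (- y))) holomorphic_on upper_hp"
    unfolding o_def
    by (intro holomorphic_on_add holomorphic_on_subset[OF transform_Ln_holomorphic sub(1)]) auto
  then have "fA A holomorphic_on upper_hp"
    by (rule holomorphic_transform) (simp add: fA_upper)
  then show ?thesis using op by (simp add: analytic_on_open)
qed

text \<open>Off the cuts Ln (-1/y) = -Ln (-y) and Ln (1/y) = -Ln y, so inversion exchanges the two
  transforms. The signs differ because the factors exp w are -y and y.\<close>

lemma fA_inversion:
  assumes y: "y \<in> upper_hp"
  shows "fA A (- 1 / y) = y * (transform U_kernel (Ln (- y)) - transform V_kernel (Ln y))"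
proof -
  have ynz: "y \<noteq> 0" and n: "y \<notin> \<real>\<^sub>\<le>\<^sub>0" "- y \<notin> \<real>\<^sub>\<le>\<^sub>0"
    using y by (auto simp: upper_hp_def complex_nonpos_Reals_iff)
  have u: "- 1 / y \<in> upper_hp" using moebius_upper_hp(2)[of 0 0 "-1" 1 y] y by simp
  have "Ln (- 1 / y) = - Ln (- y)" using Ln_inverse[OF n(2)] by (simp add: inverse_eq_divide)
  moreover have "Ln (- (- 1 / y)) = - Ln y" using Ln_inverse[OF n(1)] by (simp add: inverse_eq_divide)
  ultimately have "fA A (- 1 / y) = transform V_kernel (- Ln (- y)) + transform U_kernel (- Ln y)"
    using fA_upper[OF u] by simp
  also have "\<dots> = - exp (Ln (- y)) * transform U_kernel (Ln (- y)) + - exp (Ln y) * transform V_kernel (Ln y)"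
    by (simp only: transform_reflect[of V_kernel U_kernel, OF kernel_reflect(1)]
      transform_reflect[of U_kernel V_kernel, OF kernel_reflect(2)])
  finally show ?thesis using ynz by (simp add: algebra_simps)
qed

section \<open>The cocycles at S and -S, and the upper half-plane\<close>

lemma cocycle_extends_S: "cocycle_extends (fA A) (0, - 1, 1, 0)"
  unfolding cocycle_extends_def
proof (intro exI conjI ballI)
  have "C_gamma (0, - 1, 1, 0) = - \<real>\<^sub>\<le>\<^sub>0"
    by (auto simp: C_gamma_def complex_nonpos_Reals_iff complex_is_Real_iff)
  then show "(\<lambda>y. - 2 * transform V_kernel (Ln y)) holomorphic_on C_gamma (0, - 1, 1, 0)"
    using transform_Ln_holomorphic[of V_kernel] by (auto intro!: holomorphic_intros)
  fix y assume y: "y \<in> upper_hp"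
  then have "y \<noteq> 0" by (auto simp: upper_hp_def)
  then show "- 2 * transform V_kernel (Ln y) = cocycle 1 (0, - 1, 1, 0) (fA A) y"
    using fA_inversion[OF y] fA_upper[OF y] by (simp add: cocycle_one)
qed

lemma cocycle_extends_minus_S: "cocycle_extends (fA A) (0, 1, - 1, 0)"
  unfolding cocycle_extends_def
proof (intro exI conjI ballI)
  have "uminus ` C_gamma (0, 1, - 1, 0) \<subseteq> - \<real>\<^sub>\<le>\<^sub>0"
    by (auto simp: C_gamma_def complex_nonpos_Reals_iff complex_is_Real_iff)
  then have "((\<lambda>y. transform U_kernel (Ln y)) \<circ> uminus) holomorphic_on C_gamma (0, 1, - 1, 0)"
    by (intro holomorphic_on_compose_gen[OF _ transform_Ln_holomorphic]) (auto intro: holomorphic_intros)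
  then show "(\<lambda>y. - 2 * transform U_kernel (Ln (- y))) holomorphic_on C_gamma (0, 1, - 1, 0)"
    unfolding o_def by (intro holomorphic_intros)
  fix y assume y: "y \<in> upper_hp"
  then have "y \<noteq> 0" by (auto simp: upper_hp_def)
  then show "- 2 * transform U_kernel (Ln (- y)) = cocycle 1 (0, 1, - 1, 0) (fA A) y"
    using fA_inversion[OF y] fA_upper[OF y] by (simp add: cocycle_one)
qed

lemma fA_periodic:
  assumes "y \<in> upper_hp" shows "fA A (y + 1) = fA A y"
proof -
  have "exp (2 * of_real pi * \<i> * of_nat (m + 1) * (y + 1)) = exp (2 * of_real pi * \<i> * of_nat (m + 1) * y)" for m
  proof -
    have "exp (2 * of_real pi * \<i> * of_nat (m + 1)) = 1"
      using exp_2pi_1_nat[of "m + 1"] by (simp only: mult_ac)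
    then show ?thesis unfolding distrib_left exp_add by simp
  qed
  then show ?thesis using assms unfolding fA_def by (simp add: upper_hp_def del: of_nat_add of_nat_Suc)
qed

lemma holo_qmf_upper: "holo_qmf_on upper_hp 1 SL2Z (fA A)"
  unfolding holo_qmf_on_def
proof (intro conjI ballI fA_analytic_upper)
  fix g assume "g \<in> SL2Z"
  then obtain a b c d where g: "g = (a, b, c, d)" "a * d - b * c = 1" by (auto simp: SL2Z_def)
  have "cocycle_extends (fA A) g" unfolding g(1)
    by (rule cocycle_extends_SL2Z[OF fA_periodic cocycle_extends_S cocycle_extends_minus_S g(2)])
  then show "\<exists>h. h holomorphic_on C_gamma g \<and> (\<forall>y\<in>upper_hp. h y = cocycle 1 g (fA A) y)"
    by (simp only: cocycle_extends_def)
qed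

end

section \<open>The lower half-plane and the conclusion\<close>

lemma fA_lower: "y \<in> lower_hp \<Longrightarrow> fA A y = - fA (\<lambda>m. A (- m)) (- y)"
  by (simp add: fA_def lower_hp_def algebra_simps)

text \<open>\<open>y \<mapsto> - y\<close> swaps the half-planes; on \<open>SL\<^sub>2(\<int>)\<close> it is conjugation by \<open>diag(-1, 1)\<close>.\<close>
lemma holo_qmf_lower:
  assumes "holo_qmf_on upper_hp 1 SL2Z (fA (\<lambda>m. A (- m)))"
  shows "holo_qmf_on lower_hp 1 SL2Z (fA A)"
proof -
  let ?f = "fA (\<lambda>m. A (- m))"
  have op: "open lower_hp" "open upper_hp"
    unfolding lower_hp_def upper_hp_def by (rule open_halfspace_Im_lt open_halfspace_Im_gt)+
  have sub: "uminus ` lower_hp \<subseteq> upper_hp" by (auto simp: lower_hp_def upper_hp_def)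
  show ?thesis unfolding holo_qmf_on_def
  proof (intro conjI ballI)
    have "?f holomorphic_on upper_hp" using assms op by (simp add: holo_qmf_on_def analytic_on_open)
    then have "(?f \<circ> uminus) holomorphic_on lower_hp"
      by (intro holomorphic_on_compose_gen[OF _ _ sub]) (auto intro: holomorphic_intros)
    then have "(\<lambda>y. - ?f (- y)) holomorphic_on lower_hp"
      unfolding o_def by (intro holomorphic_intros)
    then have "fA A holomorphic_on lower_hp"
      by (rule holomorphic_transform) (simp add: fA_lower)
    then show "fA A analytic_on lower_hp" using op by (simp add: analytic_on_open)
    fix g assume "g \<in> SL2Z"
    then obtain a b c d where g: "g = (a, b, c, d)" "a * d - b * c = 1" by (auto simp: SL2Z_def)
    then have "(a, - b, - c, d) \<in> SL2Z" by (simp add: SL2Z_def)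
    then obtain h where h: "h holomorphic_on C_gamma (a, - b, - c, d)"
      "\<And>y. y \<in> upper_hp \<Longrightarrow> h y = cocycle 1 (a, - b, - c, d) ?f y"
      using assms unfolding holo_qmf_on_def by blast
    \<comment> \<open>The denominators agree, (-c) (-y) + d = c y + d, so the domains correspond
      under y -> -y and the automorphy factor is unchanged.\<close>
    have "uminus ` C_gamma g \<subseteq> C_gamma (a, - b, - c, d)" by (auto simp: C_gamma_iff g add.commute)
    then have "(h \<circ> uminus) holomorphic_on C_gamma g"
      by (intro holomorphic_on_compose_gen[OF _ h(1)]) (auto intro: holomorphic_intros)
    then have hol: "(\<lambda>y. - h (- y)) holomorphic_on C_gamma g"
      unfolding o_def by (intro holomorphic_intros)
    have "- h (- y) = cocycle 1 g (fA A) y" if y: "y \<in> lower_hp" for y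
    proof -
      let ?m = "(of_int a * y + of_int b) / (of_int c * y + of_int d) :: complex"
      have u: "- y \<in> upper_hp" using sub y by auto
      have det: "a * d - (- b) * (- c) = 1" using g(2) by simp
      have m: "(of_int a * (- y) + of_int (- b)) / (of_int (- c) * (- y) + of_int d) = - ?m"
        by (simp add: minus_divide_left)
      have "- ?m \<in> upper_hp" using moebius_upper_hp(2)[OF det u] unfolding m .
      then have "?m \<in> lower_hp" by (simp add: lower_hp_def upper_hp_def)
      then show ?thesis
        unfolding h(2)[OF u] g(1) cocycle_one m using fA_lower[OF y, of A] fA_lower[of ?m A] by simp
    qed
    then show "\<exists>h. h holomorphic_on C_gamma g \<and> (\<forall>y\<in>lower_hp. h y = cocycle 1 g (fA A) y)"
      using hol by blast
  qed
qed

theorem mainTheorem6: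
  fixes A :: "int \<Rightarrow> complex" and \<alpha> :: real and \<Lambda> :: "nat \<Rightarrow> complex \<Rightarrow> complex"
  assumes "\<alpha> \<ge> 0"
    and "\<And>\<epsilon> s. \<epsilon> \<in> {0, 1} \<Longrightarrow> Re s > \<alpha> \<Longrightarrow>
           summable (\<lambda>m. (A (int m + 1) + (-1) ^ \<epsilon> * A (- (int m + 1))) / of_nat (m + 1) powr s)"
    and "\<And>\<epsilon>. \<epsilon> \<in> {0, 1} \<Longrightarrow> \<Lambda> \<epsilon> holomorphic_on UNIV"
    and "\<And>\<epsilon>. \<epsilon> \<in> {0, 1} \<Longrightarrow> finite_order (\<Lambda> \<epsilon>)"
    and "\<And>\<epsilon> s. \<epsilon> \<in> {0, 1} \<Longrightarrow> Re s > \<alpha> \<Longrightarrow> \<Lambda> \<epsilon> s = gam (s + of_nat \<epsilon>) * Lser A \<epsilon> s"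
    and "\<And>\<epsilon> s. \<epsilon> \<in> {0, 1} \<Longrightarrow> \<Lambda> \<epsilon> (1 - s) = (-1) ^ \<epsilon> * \<Lambda> \<epsilon> s"
  shows "holo_qmf_on upper_hp 1 SL2Z (fA A) \<and> holo_qmf_on lower_hp 1 SL2Z (fA A)"
proof -
  interpret functional_equation_pair A \<alpha> \<Lambda>
    by unfold_locales (fact assms)+
  have flip: "A (- (int m + 1)) + (-1) ^ \<epsilon> * A (- (- (int m + 1)))
      = (-1) ^ \<epsilon> * (A (int m + 1) + (-1) ^ \<epsilon> * A (- (int m + 1)))" if "\<epsilon> \<in> {0, 1}" for \<epsilon> :: nat and m
    using that by (auto simp: algebra_simps)
  \<comment> \<open>Exchanging A_m and A_-m multiplies the L-series of index \<epsilon> by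
    (-1)^\<epsilon>. The completed functions take the same sign, which affects neither their order
    nor their functional equations.\<close>
  interpret minus: functional_equation_pair "\<lambda>m. A (- m)" \<alpha> "\<lambda>\<epsilon> s. (-1) ^ \<epsilon> * \<Lambda> \<epsilon> s"
  proof
    show "\<alpha> \<ge> 0" by (fact assms(1))
    fix \<epsilon> :: nat assume \<epsilon>: "\<epsilon> \<in> {0, 1}"
    show "(\<lambda>s. (-1) ^ \<epsilon> * \<Lambda> \<epsilon> s) holomorphic_on UNIV"
      by (intro holomorphic_intros assms(3) \<epsilon>)
    show "finite_order (\<lambda>s. (-1) ^ \<epsilon> * \<Lambda> \<epsilon> s)"
      using assms(4)[OF \<epsilon>] by (simp add: finite_order_def norm_mult norm_power)
    fix s :: complex
    show "(-1) ^ \<epsilon> * \<Lambda> \<epsilon> (1 - s) = (-1) ^ \<epsilon> * ((-1) ^ \<epsilon> * \<Lambda> \<epsilon> s)"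
      by (simp only: assms(6)[OF \<epsilon>])
    assume s: "Re s > \<alpha>"
    show "summable (\<lambda>m. (A (- (int m + 1)) + (-1) ^ \<epsilon> * A (- (- (int m + 1)))) / of_nat (m + 1) powr s)"
      unfolding flip[OF \<epsilon>] times_divide_eq_right[symmetric]
      by (intro summable_mult assms(2) \<epsilon> s)
    have "Lser (\<lambda>m. A (- m)) \<epsilon> s = (-1) ^ \<epsilon> * Lser A \<epsilon> s"
      unfolding Lser_def flip[OF \<epsilon>] times_divide_eq_right[symmetric]
      by (intro suminf_mult assms(2) \<epsilon> s)
    then show "(-1) ^ \<epsilon> * \<Lambda> \<epsilon> s = gam (s + of_nat \<epsilon>) * Lser (\<lambda>m. A (- m)) \<epsilon> s"
      by (simp add: assms(5)[OF \<epsilon> s])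
  qed
  show ?thesis using holo_qmf_upper holo_qmf_lower[OF minus.holo_qmf_upper] by blast
qed

end
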